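(* Let $G$ be a graph with $\chi(G)\ge 4$. If $G$ contains no subgraph isomorphic to $K_4$, then $G$ contains a cycle with at least four chords.
   Context: All graphs are finite and simple. $\chi(G)$ is the chromatic number of $G$. A chord of a cycle $C$ in $G$ is an edge of $G$ joining two vertices of $C$ that are not consecutive on $C$. *)

theory Defs
  imports Main
begin

(* A graph is a pair (vertex set, edge set), an edge being the two-element set of its ends. *)
type_synonym 'a graph = "'a set \<times> 'a set set"

abbreviation verts :: "'a graph \<Rightarrow> 'a set" where
  "verts G \<equiv> fst G"

abbreviation edges :: "'a graph \<Rightarrow> 'a set set" where
  "edges G \<equiv> snd G"

definition finite_simple_graph :: "'a graph \<Rightarrow> bool" where
  "finite_simple_graph G \<longleftrightarrow>
     finite (verts G) \<and> (\<forall>e\<in>edges G. e \<subseteq> verts G \<and> card e = 2)"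

definition proper_colouring :: "'a graph \<Rightarrow> nat \<Rightarrow> ('a \<Rightarrow> nat) \<Rightarrow> bool" where
  "proper_colouring G k c \<longleftrightarrow>
     (\<forall>v\<in>verts G. c v < k) \<and>
     (\<forall>u\<in>verts G. \<forall>v\<in>verts G. {u, v} \<in> edges G \<longrightarrow> c u \<noteq> c v)"

(* A finite simple graph is colourable with one colour per vertex, so the minimum is attained. *)
definition chromatic_number :: "'a graph \<Rightarrow> nat" where
  "chromatic_number G = (LEAST k. \<exists>c. proper_colouring G k c)"

definition subgraph :: "'a graph \<Rightarrow> 'a graph \<Rightarrow> bool" where
  "subgraph H G \<longleftrightarrow>
     finite_simple_graph H \<and> verts H \<subseteq> verts G \<and> edges H \<subseteq> edges G"

definition isomorphic :: "'a graph \<Rightarrow> 'b graph \<Rightarrow> bool" where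
  "isomorphic G H \<longleftrightarrow>
     (\<exists>f. bij_betw f (verts G) (verts H) \<and>
          (\<forall>u\<in>verts G. \<forall>v\<in>verts G. {u, v} \<in> edges G \<longleftrightarrow> {f u, f v} \<in> edges H))"

definition complete_graph :: "nat \<Rightarrow> nat graph" where
  "complete_graph n = ({..<n}, {{i, j} | i j. i < n \<and> j < n \<and> i \<noteq> j})"

(* A cycle is given by the list of its vertices in cyclic order, the last one being
   followed by the first; hence the index modulo the length. *)
definition consecutive :: "'a list \<Rightarrow> 'a \<Rightarrow> 'a \<Rightarrow> bool" where
  "consecutive C u v \<longleftrightarrow>
     (\<exists>i<length C. {u, v} = {C ! i, C ! (Suc i mod length C)})"

definition cycle :: "'a graph \<Rightarrow> 'a list \<Rightarrow> bool" where
  "cycle G C \<longleftrightarrow>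
     3 \<le> length C \<and> distinct C \<and> set C \<subseteq> verts G \<and>
     (\<forall>i<length C. {C ! i, C ! (Suc i mod length C)} \<in> edges G)"

definition chords :: "'a graph \<Rightarrow> 'a list \<Rightarrow> 'a set set" where
  "chords G C =
     {{u, v} | u v. {u, v} \<in> edges G \<and> u \<in> set C \<and> v \<in> set C \<and> \<not> consecutive C u v}"

end

theory Submission
  imports Defs
begin

text \<open>
  Take a vertex-critical induced subgraph W. Among the longest paths of W choose one whose first
  vertex has a neighbour r as far along the path as possible; the path up to r closes to a cycle C.
  If some Hamiltonian path of W[C] leads from r to s, then replacing the initial segment of the
  longest path by it shows that all neighbours of s lie on C, so s is incident with a chord of C.
  If C has at most three chords, this forces one of three situations.
  (1) Every vertex of C other than r is such an endpoint s. As r is not a cut vertex, C spans W,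
  so C has at most six vertices, and W is 3-colourable or a complete graph on four vertices.
  (2) W[C] is the complete bipartite graph with parts of size three, and two vertices on the side
  not containing r have the same neighbours, which is impossible in a critical graph.
  (3) The six chord ends have degree three and induce a hexagon (as in the Petersen graph minus a
  vertex). A 3-colouring of the rest of W leaves two colours for each vertex of that even cycle and
  therefore extends to W.
\<close>

section \<open>Hamiltonian cycles with at most three chords\<close>

text \<open>Stretches of the cycle, run forwards and backwards. As constants with simp rules for
  their sets and ends, they let the simplifier check the Hamiltonian paths below, which are
  concatenations of such stretches and single indices.\<close>

definition up :: "nat \<Rightarrow> nat \<Rightarrow> nat list" where "up a b = [a..<Suc b]"
definition dn :: "nat \<Rightarrow> nat \<Rightarrow> nat list" where "dn a b = rev (up a b)"

lemma up_simps [simp]: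
  "set (up a b) = {a..b}" "distinct (up a b)" "up a b = [] \<longleftrightarrow> b < a"
  "a \<le> b \<Longrightarrow> hd (up a b) = a" "a \<le> b \<Longrightarrow> last (up a b) = b"
  by (auto simp: up_def simp del: upt_Suc)

lemma dn_simps [simp]:
  "set (dn a b) = {a..b}" "distinct (dn a b)" "dn a b = [] \<longleftrightarrow> b < a"
  "a \<le> b \<Longrightarrow> hd (dn a b) = b" "a \<le> b \<Longrightarrow> last (dn a b) = a"
  by (auto simp: dn_def hd_rev last_rev)

text \<open>
  A graph on the indices 0, ..., q + 1 with these indices in cyclic order as a Hamiltonian cycle;
  the root r has index 0.
\<close>
locale spanning_cycle =
  fixes q :: nat and E :: "nat \<Rightarrow> nat \<Rightarrow> bool"
  assumes q_ge_2: "2 \<le> q"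
    and sym: "E i j \<Longrightarrow> E j i"
    and step: "i \<le> q \<Longrightarrow> E i (Suc i)"
    and close: "E 0 (Suc q)"
begin

text \<open>Listing the smaller index first counts each chord once; \<open>(0, Suc q)\<close> is
  excluded because it is the closing edge of the cycle.\<close>

definition chord_pairs :: "(nat \<times> nat) set" where
  "chord_pairs = {(i, j). Suc (Suc i) \<le> j \<and> j \<le> Suc q \<and> (i, j) \<noteq> (0, Suc q) \<and> E i j}"

text \<open>Paths start at 0 because the rest of the longest path continues from there: a
  Hamiltonian path from 0 to \<open>s\<close> makes the vertex at \<open>s\<close> the first vertex
  of another longest path.\<close>

definition endpoint :: "nat \<Rightarrow> bool" where
  "endpoint s \<longleftrightarrow> (\<exists>xs. successively E xs \<and> distinct xs \<and> set xs = {0..Suc q} \<and>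
     hd xs = 0 \<and> last xs = s)"

lemma chord_pairsD: "(i, j) \<in> chord_pairs \<Longrightarrow> E i j \<and> E j i \<and> Suc (Suc i) \<le> j \<and> j \<le> Suc q \<and> \<not> (i = 0 \<and> j = Suc q)"
  using sym by (auto simp: chord_pairs_def)

lemma finite_chord_pairs [simp]: "finite chord_pairs"
  by (rule finite_subset[of _ "{0..Suc q} \<times> {0..Suc q}"]) (auto simp: chord_pairs_def)

lemma E_step [simp]:
  "j = Suc i \<Longrightarrow> i \<le> q \<Longrightarrow> E i j" "i = Suc j \<Longrightarrow> j \<le> q \<Longrightarrow> E i j"
  using step sym by auto

lemma E_close [simp]: "E 0 (Suc q)" "E (Suc q) 0"
  using close sym by auto

lemma successively_up [simp]: "b \<le> Suc q \<Longrightarrow> successively E (up a b)"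
  by (auto simp: up_def successively_conv_nth simp del: upt_Suc)

lemma successively_dn [simp]: "b \<le> Suc q \<Longrightarrow> successively E (dn a b)"
  by (auto simp: up_def dn_def successively_conv_nth rev_nth simp del: upt_Suc)

section \<open>Hamiltonian paths from the root\<close>

lemma endpointI:
  assumes "successively E xs" "distinct xs" "set xs = {0..Suc q}" "hd xs = 0" "last xs = s"
  shows "endpoint s"
  using assms by (auto simp: endpoint_def)

lemmas path_simps = successively_Cons successively_append_iff

lemma endpoint_1: "endpoint 1"
  by (rule endpointI[of "0 # dn 1 (Suc q)"]) (auto simp: path_simps)

lemma endpoint_Suc_q: "endpoint (Suc q)"
  by (rule endpointI[of "up 0 (Suc q)"]) auto

text \<open>Posa rotation: the path 0, q+1, ..., 1 ends at 1, and the chord from 1 to a+1 replaces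
  the edge from a+1 to a. \<open>endpoint_after\<close> is the mirror image, rotating the path 0, 1,
  ..., q+1.\<close>

lemma endpoint_before:
  assumes "(1, Suc a) \<in> chord_pairs" shows "endpoint a"
  by (rule endpointI[of "0 # dn (Suc a) (Suc q) @ up 1 a"]) 
    (use chord_pairsD[OF assms] in \<open>auto simp: path_simps\<close>)

lemma endpoint_after: 
  assumes "(b, Suc q) \<in> chord_pairs" shows "endpoint (Suc b)"
  by (rule endpointI[of "0 # up 1 b @ dn (Suc b) (Suc q)"]) 
    (use chord_pairsD[OF assms] in \<open>auto simp: path_simps\<close>)

lemma edge_cases:
  assumes "E i j" "\<not> E i i" "i \<le> Suc q" "j \<le> Suc q"
  shows "j = Suc i \<or> i = Suc j \<or> (i, j) \<in> {(0, Suc q), (Suc q, 0)} \<or> (i, j) \<in> chord_pairs \<or> (j, i) \<in> chord_pairs"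
proof (cases i j rule: linorder_cases)
  case less then show ?thesis using assms by (auto simp: chord_pairs_def)
next
  case equal then show ?thesis using assms by auto
next
  case greater then show ?thesis using assms sym[of i j] by (auto simp: chord_pairs_def)
qed

lemma endpoint_le: "endpoint s \<Longrightarrow> s \<le> Suc q"
  unfolding endpoint_def by (metis atLeastAtMost_iff empty_iff last_in_set list.set(1) zero_le)

text \<open>If every index is a chord end, three chords leave room for at most six indices, so q is
  2, 3 or 4. With four indices both diagonals are present; with five or six, explicit colourings
  settle the few possible chord sets.\<close>

lemma small_spanning_cycle:
  assumes irrefl: "\<And>i. \<not> E i i" and few: "card chord_pairs \<le> 3"
    and cover: "\<And>s. s \<le> Suc q \<Longrightarrow> \<exists>t. (s, t) \<in> chord_pairs \<or> (t, s) \<in> chord_pairs"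
  shows "(q = 2 \<and> E 0 2 \<and> E 1 3) \<or>
    (\<exists>c::nat \<Rightarrow> nat. (\<forall>i\<le>Suc q. c i < 3) \<and> (\<forall>i\<le>Suc q. \<forall>j\<le>Suc q. E i j \<longrightarrow> c i \<noteq> c j))"
proof -
  \<comment> \<open>It suffices to check a list of colours on the cycle edges and on any list
    \<open>es\<close> containing all chords.\<close>
  have colour: "\<exists>c::nat \<Rightarrow> nat. (\<forall>i\<le>Suc q. c i < 3) \<and> (\<forall>i\<le>Suc q. \<forall>j\<le>Suc q. E i j \<longrightarrow> c i \<noteq> c j)"
    if c3: "\<forall>k\<in>set cs. k < (3::nat)" and len: "length cs = Suc (Suc q)"
      and cyc: "\<forall>i\<le>q. cs ! i \<noteq> cs ! Suc i" "cs ! 0 \<noteq> cs ! Suc q"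
      and ch: "chord_pairs \<subseteq> set es" "\<forall>(i, j)\<in>set es. cs ! i \<noteq> cs ! j" for cs es
  proof -
    have lt: "cs ! i \<noteq> cs ! j" if "i < j" "j \<le> Suc q" "E i j" for i j
    proof (cases "j = Suc i")
      case True
      with cyc that show ?thesis by auto
    next
      case False
      with that have "(i = 0 \<and> j = Suc q) \<or> (i, j) \<in> chord_pairs"
        unfolding chord_pairs_def by auto
      with cyc ch show ?thesis by auto
    qed
    show ?thesis
    proof (intro exI[of _ "(!) cs"] conjI allI impI)
      show "cs ! i < 3" if "i \<le> Suc q" for i
        using c3 len that by simp
      show "cs ! i \<noteq> cs ! j" if "i \<le> Suc q" "j \<le> Suc q" "E i j" for i j
        using lt[of i j] lt[of j i] sym that irrefl by (metis linorder_neqE_nat)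
    qed
  qed
  have "{0..Suc q} \<subseteq> (\<Union>e\<in>chord_pairs. {fst e, snd e})"
    using cover by fastforce
  then have "card {0..Suc q} \<le> card (\<Union>e\<in>chord_pairs. {fst e, snd e})"
    by (intro card_mono) auto
  also have "\<dots> \<le> (\<Sum>e\<in>chord_pairs. card {fst e, snd e})"
    by (intro card_UN_le) auto
  also have "\<dots> \<le> (\<Sum>e\<in>chord_pairs. 2)"
    by (intro sum_mono) (auto simp: card_insert_if)
  finally consider "q = 2" | "q = 3" | "q = 4"
    using few q_ge_2 by fastforce
  then show ?thesis
  proof cases
    case q: 1
    obtain t where "(0, t) \<in> chord_pairs" using cover[of 0] chord_pairsD[of _ 0] by auto
    then have "E 0 2" using chord_pairsD[of 0 t] q by (cases "t = 2") auto
    obtain t where "(1, t) \<in> chord_pairs" using cover[of 1] chord_pairsD[of _ 1] by auto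
    then have "E 1 3" using chord_pairsD[of 1 t] q by (cases "t = 3") auto
    with \<open>E 0 2\<close> q show ?thesis by simp
  next
    case q: 2
    have opt: "(i, j) \<in> {(0,2),(0,3),(1,3),(1,4),(2,4)}" if "(i, j) \<in> chord_pairs" for i j
    proof -
      have "Suc (Suc i) \<le> j" "j \<le> 4" "\<not> (i = 0 \<and> j = 4)"
        using chord_pairsD[OF that] q by simp_all
      then show ?thesis unfolding insert_iff prod.inject empty_iff by presburger
    qed
    have "\<exists>g\<in>chord_pairs. g \<in> {(0,2),(0,3)}" using cover[of 0] opt by fastforce
    moreover have "\<exists>g\<in>chord_pairs. g \<in> {(1,3),(1,4)}" using cover[of 1] opt q by fastforce
    moreover have "\<exists>g\<in>chord_pairs. g \<in> {(0,2),(2,4)}" using cover[of 2] opt q by fastforce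
    moreover have "\<exists>g\<in>chord_pairs. g \<in> {(0,3),(1,3)}" using cover[of 3] opt q by fastforce
    moreover have "\<exists>g\<in>chord_pairs. g \<in> {(1,4),(2,4)}" using cover[of 4] opt q by fastforce
    ultimately obtain g0 g1 g2 g3 g4 where g: "g0 \<in> chord_pairs" "g1 \<in> chord_pairs"
      "g2 \<in> chord_pairs" "g3 \<in> chord_pairs" "g4 \<in> chord_pairs"
      "g0 \<in> {(0,2),(0,3)}" "g1 \<in> {(1,3),(1,4)}" "g2 \<in> {(0,2),(2,4)}" "g3 \<in> {(0,3),(1,3)}" "g4 \<in> {(1,4),(2,4)}"
      by blast
    \<comment> \<open>Chords chosen one at each of five vertices include three different ones, hence
      all chords. The five diagonals of the pentagon form a second 5-cycle, and three of them that
      cover all vertices omit two disjoint diagonals; this gives the five cases.\<close>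
    have "3 \<le> card {g0, g1, g2, g3, g4}"
      using g(6-) by (elim insertE emptyE) (simp_all add: card_insert_if)
    with few g(1-5) have "chord_pairs = {g0, g1, g2, g3, g4}"
      by (intro card_seteq[symmetric]) auto
    then have "(0,2) \<notin> chord_pairs \<and> (1,3) \<notin> chord_pairs \<or> (0,2) \<notin> chord_pairs \<and> (1,4) \<notin> chord_pairs \<or> (0,3) \<notin> chord_pairs \<and> (1,4) \<notin> chord_pairs
      \<or> (0,3) \<notin> chord_pairs \<and> (2,4) \<notin> chord_pairs \<or> (1,3) \<notin> chord_pairs \<and> (2,4) \<notin> chord_pairs"
      using g(6-) few by (elim insertE emptyE) (simp_all add: card_insert_if)
    moreover have all: "(\<forall>i\<le>(3::nat). P i) \<longleftrightarrow> P 0 \<and> P 1 \<and> P 2 \<and> P 3" for P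
      by (auto simp: numeral_eq_Suc le_Suc_eq)
    ultimately show ?thesis
    proof (elim disjE)
      assume "(0,2) \<notin> chord_pairs \<and> (1,3) \<notin> chord_pairs" then have "chord_pairs \<subseteq> set [(0,3), (1,4), (2,4)]" using opt by fastforce
      then show ?thesis
        by (rule disjI2[OF colour[rotated 4, of _ "[0,1,0,1,2]"]]) (use q in \<open>auto simp: all\<close>)
    next
      assume "(0,2) \<notin> chord_pairs \<and> (1,4) \<notin> chord_pairs" then have "chord_pairs \<subseteq> set [(0,3), (1,3), (2,4)]" using opt by fastforce
      then show ?thesis
        by (rule disjI2[OF colour[rotated 4, of _ "[0,1,0,2,1]"]]) (use q in \<open>auto simp: all\<close>)
    next
      assume "(0,3) \<notin> chord_pairs \<and> (1,4) \<notin> chord_pairs" then have "chord_pairs \<subseteq> set [(0,2), (1,3), (2,4)]" using opt by fastforce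
      then show ?thesis
        by (rule disjI2[OF colour[rotated 4, of _ "[0,1,2,0,1]"]]) (use q in \<open>auto simp: all\<close>)
    next
      assume "(0,3) \<notin> chord_pairs \<and> (2,4) \<notin> chord_pairs" then have "chord_pairs \<subseteq> set [(0,2), (1,3), (1,4)]" using opt by fastforce
      then show ?thesis
        by (rule disjI2[OF colour[rotated 4, of _ "[0,1,2,0,2]"]]) (use q in \<open>auto simp: all\<close>)
    next
      assume "(1,3) \<notin> chord_pairs \<and> (2,4) \<notin> chord_pairs" then have "chord_pairs \<subseteq> set [(0,2), (0,3), (1,4)]" using opt by fastforce
      then show ?thesis
        by (rule disjI2[OF colour[rotated 4, of _ "[0,1,2,1,2]"]]) (use q in \<open>auto simp: all\<close>)
    qed
  next
    case q: 3
    have opt: "(i, j) \<in> {(0,2),(0,3),(0,4),(1,3),(1,4),(1,5),(2,4),(2,5),(3,5)}" if "(i, j) \<in> chord_pairs" for i j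
    proof -
      have "Suc (Suc i) \<le> j" "j \<le> 5" "\<not> (i = 0 \<and> j = 5)"
        using chord_pairsD[OF that] q by simp_all
      then show ?thesis unfolding insert_iff prod.inject empty_iff by presburger
    qed
    \<comment> \<open>If two of at most three chords shared an end, at most five of the six indices
      would be covered. So the chords form a perfect matching.\<close>
    have disj: False
      if e: "e \<in> chord_pairs" "e' \<in> chord_pairs" "e \<noteq> e'" "s \<in> {fst e, snd e}" "s \<in> {fst e', snd e'}" for e e' s
    proof -
      let ?U = "\<Union>x\<in>chord_pairs - {e}. {fst x, snd x}"
      have "{0..Suc q} \<subseteq> (\<Union>x\<in>chord_pairs. {fst x, snd x})"
        using cover by fastforce
      also have "\<dots> \<subseteq> ?U \<union> ({fst e, snd e} - {s})"
        using e by blast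
      finally have "card {0..Suc q} \<le> card (?U \<union> ({fst e, snd e} - {s}))"
        by (intro card_mono) auto
      also have "\<dots> \<le> card ?U + card ({fst e, snd e} - {s})"
        by (rule card_Un_le)
      also have "card ({fst e, snd e} - {s}) \<le> 1"
        using e(4) by (cases "fst e = snd e") (auto simp: card_insert_if)
      also have "card ?U \<le> (\<Sum>x\<in>chord_pairs - {e}. card {fst x, snd x})"
        by (intro card_UN_le) auto
      also have "\<dots> \<le> (\<Sum>x\<in>chord_pairs - {e}. 2)"
        by (intro sum_mono) (auto simp: card_insert_if)
      finally show False
        using q few e(1) by simp
    qed
    have no: "e = e'" if "e \<in> chord_pairs" "e' \<in> chord_pairs" "{fst e, snd e} \<inter> {fst e', snd e'} \<noteq> {}" for e e'
      using disj[of e e'] that by blast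
    have n: "(i, j) \<notin> chord_pairs" if "(k, l) \<in> chord_pairs" "i = k \<or> i = l \<or> j = k \<or> j = l" "(i, j) \<noteq> (k, l)" for i j k l
      using no[of "(i, j)" "(k, l)"] that by auto
    have cov0: "(0,2) \<in> chord_pairs \<or> (0,3) \<in> chord_pairs \<or> (0,4) \<in> chord_pairs"
      using cover[of 0] opt q by fastforce
    have cov1: "(1,3) \<in> chord_pairs \<or> (1,4) \<in> chord_pairs \<or> (1,5) \<in> chord_pairs"
      using cover[of 1] opt q by fastforce
    have cov2: "(0,2) \<in> chord_pairs \<or> (2,4) \<in> chord_pairs \<or> (2,5) \<in> chord_pairs"
      using cover[of 2] opt q by fastforce
    have cov3: "(0,3) \<in> chord_pairs \<or> (1,3) \<in> chord_pairs \<or> (3,5) \<in> chord_pairs"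
      using cover[of 3] opt q by fastforce
    have cov4: "(0,4) \<in> chord_pairs \<or> (1,4) \<in> chord_pairs \<or> (2,4) \<in> chord_pairs"
      using cover[of 4] opt q by fastforce
    have cov5: "(1,5) \<in> chord_pairs \<or> (2,5) \<in> chord_pairs \<or> (3,5) \<in> chord_pairs"
      using cover[of 5] opt q by fastforce
    \<comment> \<open>The three long diagonals complete the hexagon to the complete bipartite graph;
      the other three matchings, rotations of one another, give the triangular prism.\<close>
    have "chord_pairs = {(0,3),(1,4),(2,5)} \<or> chord_pairs = {(0,2),(1,4),(3,5)} \<or> chord_pairs = {(1,3),(2,5),(0,4)} \<or> chord_pairs = {(2,4),(0,3),(1,5)}"
    proof -
      have seteq: "chord_pairs = {(a, b), (c, d), (e, f)}" if "(a, b) \<in> chord_pairs" "(c, d) \<in> chord_pairs" "(e, f) \<in> chord_pairs"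
        "(a, b) \<noteq> (c, d)" "(a, b) \<noteq> (e, f)" "(c, d) \<noteq> (e, f)" for a b c d e f
        using that few by (intro card_seteq[symmetric]) auto
      from cov0 show ?thesis
      proof (elim disjE)
        assume a: "(0,2) \<in> chord_pairs"
        then have no: "(2,4) \<notin> chord_pairs" "(2,5) \<notin> chord_pairs" "(0,3) \<notin> chord_pairs" "(0,4) \<notin> chord_pairs" using n[OF a] by auto
        with cov4 have b: "(1,4) \<in> chord_pairs" by auto
        then have "(1,5) \<notin> chord_pairs" using n[OF b] by auto
        with no cov5 have "(3,5) \<in> chord_pairs" by auto
        with a b show ?thesis using seteq[of 0 2 1 4 3 5] by simp
      next
        assume a: "(0,3) \<in> chord_pairs"
        then have no: "(1,3) \<notin> chord_pairs" "(3,5) \<notin> chord_pairs" "(0,2) \<notin> chord_pairs" "(0,4) \<notin> chord_pairs" using n[OF a] by auto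
        show ?thesis
        proof (cases "(1,4) \<in> chord_pairs")
          case True
          with n[OF True, of 1 5] no cov5 have "(2,5) \<in> chord_pairs" by auto
          with True a show ?thesis using seteq[of 0 3 1 4 2 5] by simp
        next
          case False
          with no cov1 cov4 have "(1,5) \<in> chord_pairs" "(2,4) \<in> chord_pairs" by auto
          with a show ?thesis using seteq[of 2 4 0 3 1 5] by simp
        qed
      next
        assume a: "(0,4) \<in> chord_pairs"
        then have no: "(1,4) \<notin> chord_pairs" "(2,4) \<notin> chord_pairs" "(0,2) \<notin> chord_pairs" "(0,3) \<notin> chord_pairs" using n[OF a] by auto
        with no cov2 have b: "(2,5) \<in> chord_pairs" by auto
        then have "(1,5) \<notin> chord_pairs" using n[OF b] by auto
        with no cov1 have "(1,3) \<in> chord_pairs" by auto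
        with a b show ?thesis using seteq[of 1 3 2 5 0 4] by simp
      qed
    qed
    moreover have all: "(\<forall>i\<le>(4::nat). P i) \<longleftrightarrow> P 0 \<and> P 1 \<and> P 2 \<and> P 3 \<and> P 4" for P
      by (auto simp: numeral_eq_Suc le_Suc_eq)
    ultimately show ?thesis
    proof (elim disjE)
      assume "chord_pairs = {(0,3),(1,4),(2,5)}" then have "chord_pairs \<subseteq> set [(0,3),(1,4),(2,5)]" by simp
      then show ?thesis
        by (rule disjI2[OF colour[rotated 4, of _ "[0,1,0,1,0,1]"]]) (use q in \<open>auto simp: all\<close>)
    next
      assume "chord_pairs = {(0,2),(1,4),(3,5)}" then have "chord_pairs \<subseteq> set [(0,2),(1,4),(3,5)]" by simp
      then show ?thesis
        by (rule disjI2[OF colour[rotated 4, of _ "[0,1,2,0,2,1]"]]) (use q in \<open>auto simp: all\<close>)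
    next
      assume "chord_pairs = {(1,3),(2,5),(0,4)}" then have "chord_pairs \<subseteq> set [(1,3),(2,5),(0,4)]" by simp
      then show ?thesis
        by (rule disjI2[OF colour[rotated 4, of _ "[1,0,1,2,0,2]"]]) (use q in \<open>auto simp: all\<close>)
    next
      assume "chord_pairs = {(2,4),(0,3),(1,5)}" then have "chord_pairs \<subseteq> set [(2,4),(0,3),(1,5)]" by simp
      then show ?thesis
        by (rule disjI2[OF colour[rotated 4, of _ "[2,1,0,1,2,0]"]]) (use q in \<open>auto simp: all\<close>)
    qed
  qed
qed

end

text \<open>
  The assumption on endpoints is the only trace of the longest path: it makes every Hamiltonian path
  from 0 that one can exhibit reveal a chord end, and three chords have at most six ends.
\<close>
locale sparse_lollipop = spanning_cycle +
  assumes few: "card chord_pairs \<le> 3"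
    and chorded: "endpoint s \<Longrightarrow> \<exists>t. (s, t) \<in> chord_pairs \<or> (t, s) \<in> chord_pairs"
begin

section \<open>Chord configurations that the endpoints allow\<close>

lemma three_chords:
  assumes "(a, b) \<in> chord_pairs" "(c, d) \<in> chord_pairs" "(e, f) \<in> chord_pairs"
    "(a, b) \<noteq> (c, d)" "(a, b) \<noteq> (e, f)" "(c, d) \<noteq> (e, f)"
  shows "chord_pairs = {(a, b), (c, d), (e, f)}" 
    and "endpoint s \<Longrightarrow> s \<in> {a, b, c, d, e, f}"
proof -
  show *: "chord_pairs = {(a, b), (c, d), (e, f)}"
    using assms few by (intro card_seteq[symmetric]) auto
  show "s \<in> {a, b, c, d, e, f}" if "endpoint s"
    using chorded[OF that] unfolding * by auto
qed

text \<open>With two chords known, only one more is possible; it must serve both \<open>s\<close>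
  and \<open>t\<close>, which are endpoints missed by the first two.\<close>

lemma third_chord:
  assumes "(a, b) \<in> chord_pairs" "(c, d) \<in> chord_pairs" "(a, b) \<noteq> (c, d)" "endpoint s" "endpoint t"
    "s < t" "s \<notin> {a, b, c, d}" "t \<notin> {a, b, c, d}"
  shows "(s, t) \<in> chord_pairs"
proof -
  obtain s' where s': "(s, s') \<in> chord_pairs \<or> (s', s) \<in> chord_pairs"
    using chorded assms by blast
  then obtain e f where ef: "(e, f) \<in> chord_pairs" "s \<in> {e, f}"
    by auto
  have "(a, b) \<noteq> (e, f)" "(c, d) \<noteq> (e, f)"
    using ef assms by auto
  from three_chords(2)[OF assms(1,2) ef(1) assms(3) this assms(5)] have "t \<in> {e, f}" 
    using assms by auto
  with chord_pairsD[OF ef(1)] ef \<open>s < t\<close> show ?thesis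
    by auto
qed

text \<open>Here 0, 1 and q+1 form a triangle, and rotations give the endpoints 1, 2, q and q+1.
  Beyond q = 3 the chord at 2 is examined: each choice of its other end either produces an endpoint
  that is no chord end or forces a cycle so short that every index but 0 is seen to be an
  endpoint.\<close>

lemma all_endpoints_if_root_triangle:
  assumes 1: "(1, Suc q) \<in> chord_pairs"
  shows "\<forall>s\<in>{1..Suc q}. endpoint s"
proof -
  note D1 = chord_pairsD[OF 1]
  have e: "endpoint 1" "endpoint (Suc q)" "endpoint q" "endpoint 2"
    using endpoint_1 endpoint_Suc_q endpoint_before[OF 1] endpoint_after[OF 1] 
    by (simp_all add: numeral_2_eq_2)
  consider "q = 2" | "q = 3" | "q \<ge> 4" using q_ge_2 by linarith
  then show ?thesis
  proof cases
    case 1 with e show ?thesis by (auto simp: le_Suc_eq numeral_eq_Suc)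
  next
    case 2 with e show ?thesis by (auto simp: le_Suc_eq numeral_eq_Suc)
  next
    case q: 3
    show ?thesis
    proof (cases "(2, q) \<in> chord_pairs")
      case True
      note D2 = chord_pairsD[OF True]
      obtain u where u: "q = Suc u" using q by (cases q) auto
      have e3: "endpoint 3"
        by (rule endpointI[of "[0, Suc q, 1, 2] @ dn 3 q"])
          (use D1 D2 q in \<open>auto simp: path_simps\<close>)
      have eu: "endpoint u"
        by (rule endpointI[of "[0, 1, Suc q, q] @ up 2 u"])
          (use D1 D2 q u in \<open>auto simp: path_simps\<close>)
      consider "u = 3" | "u = 4" | "u \<ge> 5" using q u by linarith
      then show ?thesis
      proof cases
        case 1 with e e3 u show ?thesis by (auto simp: le_Suc_eq numeral_eq_Suc)
      next
        case 2 with e e3 eu u show ?thesis by (auto simp: le_Suc_eq numeral_eq_Suc)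
      next
        case 3
        have 3: "(3, u) \<in> chord_pairs"
          using third_chord[OF 1 True _ e3 eu] q u 3 by auto
        have "endpoint 4"
          by (rule endpointI[of "[0, 1, Suc q, q, 2, 3] @ dn 4 u"])
            (use D1 D2 chord_pairsD[OF 3] q u \<open>u \<ge> 5\<close> in \<open>auto simp: path_simps\<close>)
        from three_chords(2)[OF 1 True 3 _ _ _ this] show ?thesis 
          using u \<open>u \<ge> 5\<close> by auto
      qed
    next
      case False
      \<comment> \<open>If 3 were an endpoint, the third chord would have to join 3 and q, and then
        4 would be an endpoint that is no chord end.\<close>
      have contra: "\<not> endpoint 3" if t: "(0, 2) \<in> chord_pairs \<or> (2, Suc q) \<in> chord_pairs"
      proof
        assume e3: "endpoint 3"
        from t obtain a b where ab: "(a, b) \<in> chord_pairs" "(a, b) = (0, 2) \<or> (a, b) = (2, Suc q)"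
          by auto
        have 3: "(3, q) \<in> chord_pairs"
          using third_chord[OF 1 ab(1) _ e3 e(3)] ab(2) q by auto
        have "endpoint 4"
          by (rule endpointI[of "[0, Suc q, 1, 2, 3] @ dn 4 q"])
            (use D1 chord_pairsD[OF 3] q in \<open>auto simp: path_simps\<close>)
        from three_chords(2)[OF 1 ab(1) 3 _ _ _ this] ab(2) q chord_pairsD[OF 3] show False
          by auto
      qed
      obtain t where t: "(2, t) \<in> chord_pairs \<or> (t, 2) \<in> chord_pairs" using chorded e by blast
      then consider "(0, 2) \<in> chord_pairs" | "(2, Suc q) \<in> chord_pairs" | v where "(2, Suc v) \<in> chord_pairs" "3 \<le> v" "Suc v < q"
      proof -
        assume *: "(0, 2) \<in> chord_pairs \<Longrightarrow> thesis" "(2, Suc q) \<in> chord_pairs \<Longrightarrow> thesis"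
          "\<And>v. (2, Suc v) \<in> chord_pairs \<Longrightarrow> 3 \<le> v \<Longrightarrow> Suc v < q \<Longrightarrow> thesis"
        from t show thesis
        proof
          assume t: "(2, t) \<in> chord_pairs"
          then have "t \<noteq> q" "t \<ge> 4" "t \<le> Suc q" using False chord_pairsD[OF t] by auto
          then show thesis using t * by (cases t; cases "t = Suc q") auto
        next
          assume t: "(t, 2) \<in> chord_pairs"
          then have "t = 0" using chord_pairsD[OF t] by auto
          then show thesis using t * by auto
        qed
      qed
      then show ?thesis
      proof cases
        case c: 1
        have "endpoint 3"
          by (rule endpointI[of "[0, 2, 1] @ dn 3 (Suc q)"])
            (use D1 chord_pairsD[OF c] q in \<open>auto simp: path_simps\<close>)
        with contra c show ?thesis by blast
      next
        case c: 2
        have "endpoint 3"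
          by (rule endpointI[of "[0, 1, 2] @ dn 3 (Suc q)"])
            (use D1 chord_pairsD[OF c] q in \<open>auto simp: path_simps\<close>)
        with contra c show ?thesis by blast
      next
        case c: 3
        note D2 = chord_pairsD[OF c(1)]
        have ev: "endpoint v"
          by (rule endpointI[of "[0, 1] @ dn (Suc v) (Suc q) @ up 2 v"])
            (use D1 D2 c q in \<open>auto simp: path_simps\<close>)
        have 3: "(v, q) \<in> chord_pairs"
          using third_chord[OF 1 c(1) _ ev e(3)] c q by auto
        note D3 = chord_pairsD[OF 3]
        obtain u where u: "q = Suc u" using q by (cases q) auto
        have eu: "endpoint u"
          by (rule endpointI[of "[0, 1, Suc q, q] @ dn 2 v @ up (Suc v) u"])
            (use E_close D1 D2 D3 c q u in \<open>auto simp: path_simps\<close>)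
        have e3: "endpoint 3"
          by (rule endpointI[of "[0, Suc q, 1, 2] @ up (Suc v) q @ dn 3 v"])
            (use E_close D1 D2 D3 c q u in \<open>auto simp: path_simps\<close>)
        have v: "v = 3" "u = Suc v"
          using three_chords(2)[OF 1 c(1) 3 _ _ _ e3] three_chords(2)[OF 1 c(1) 3 _ _ _ eu] c u D3 by auto
        with e eu e3 u show ?thesis 
          by (auto simp: le_Suc_eq numeral_eq_Suc)
      qed
    qed
  qed
qed


text \<open>The chords from 1 and q+1 cross and end at the consecutive indices a+1 and a. Repeated
  rotation makes 1, 2, a, a+1, q and q+1 endpoints; if these are six different indices, the third
  chord must join 2 and q. Apart from the hexagon, the cases are short cycles on which every index
  but 0 is an endpoint, or yield an endpoint that is no chord end.\<close>

lemma crossing_chords_cases: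
  assumes 1: "(1, Suc a) \<in> chord_pairs" and 2: "(a, Suc q) \<in> chord_pairs"
  shows "(\<forall>s\<in>{1..Suc q}. endpoint s) \<or>
    (4 \<le> a \<and> a + 3 \<le> q \<and> chord_pairs = {(1, Suc a), (a, Suc q), (2, q)} \<and>
     (\<forall>s\<in>{1, 2, a, Suc a, q, Suc q}. endpoint s))"
proof -
  note D1 = chord_pairsD[OF 1] and D2 = chord_pairsD[OF 2]
  have a: "2 \<le> a" "a < q" using D1 D2 by auto
  have e2: "endpoint 2"
    by (rule endpointI[of "[0, 1] @ up (Suc a) (Suc q) @ dn 2 a"])
      (use D1 D2 a in \<open>auto simp: path_simps\<close>)
  have eq: "endpoint q"
    by (rule endpointI[of "[0, Suc q] @ dn 1 a @ up (Suc a) q"])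
      (use D1 D2 a in \<open>auto simp: path_simps\<close>)
  note e = endpoint_1 endpoint_Suc_q endpoint_before[OF 1] endpoint_after[OF 2] e2 eq
  consider "a = 2" "q = 3" | "a = 2" "q = 4" | "a = 2" "5 \<le> q" 
    | "a = 3" "q = 4" | "4 \<le> a" "q = Suc a" | "3 \<le> a" "a + 2 \<le> q" 
    using a by linarith
  then show ?thesis
  proof cases
    case 1 with e show ?thesis by (auto simp: le_Suc_eq numeral_eq_Suc)
  next
    case 2 with e show ?thesis by (auto simp: le_Suc_eq numeral_eq_Suc)
  next
    case 4 with e show ?thesis by (auto simp: le_Suc_eq numeral_eq_Suc)
  next
    \<comment> \<open>The endpoint q needs the third chord. Wherever its other end t lies, some
      endpoint turns out not to be a chord end.\<close>
    case c: 3
    obtain r where r: "q = Suc r" using c by (cases q) auto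
    obtain t where t: "(q, t) \<in> chord_pairs \<or> (t, q) \<in> chord_pairs" using chorded eq by blast
    have tq: "(t, q) \<in> chord_pairs"
      using t chord_pairsD[of q t] by auto
    note D3 = chord_pairsD[OF tq]
    note th = three_chords(2)[OF 1 2 tq]
    have no: "\<not> endpoint s" if "4 \<le> s" "s < q" "s \<noteq> t" for s
      using th[of s] that c by auto
    have t_neq: "t \<noteq> Suc q" "t \<noteq> q" "t < r" using D3 r by auto
    consider "t = 0" | "t = 1" | "t = 2" | "3 \<le> t" by linarith
    then have False
    proof cases
      case t: 1
      have "endpoint r"
        by (rule endpointI[of "[0, q, Suc q, 2, 1] @ up 3 r"])
          (use E_close D1 D2 D3 c r t in \<open>auto simp: path_simps\<close>)
      with no c r t show False by auto
    next
      case t: 2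
      have "endpoint 4"
        by (rule endpointI[of "[0, Suc q, 2, 3, 1] @ dn 4 q"])
          (use E_close D1 D2 D3 c r t in \<open>auto simp: path_simps\<close>)
      with no c r t show False by auto
    next
      case t: 3
      have "endpoint r"
        by (rule endpointI[of "[0, Suc q, q, 2, 1] @ up 3 r"])
          (use E_close D1 D2 D3 c r t in \<open>auto simp: path_simps\<close>)
      with no c r t show False by auto
    next
      case t: 4
      have "endpoint (Suc t)"
        by (rule endpointI[of "[0, Suc q, 2, 1] @ up 3 t @ dn (Suc t) q"])
          (use E_close D1 D2 D3 c r t in \<open>auto simp: path_simps\<close>)
      with no c r t t_neq show False by auto
    qed
    then show ?thesis ..
  next
    \<comment> \<open>Mirror image of the case \<open>a = 2\<close>, \<open>5 \<le> q\<close>, with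
      the third chord now at 2.\<close>
    case c: 5
    obtain r where r: "a = Suc r" using c by (cases a) auto
    obtain t where t: "(2, t) \<in> chord_pairs \<or> (t, 2) \<in> chord_pairs" using chorded e2 by blast
    from t have Et: "E 2 t" "E t 2" and t_cases: "t = 0 \<or> 4 \<le> t \<and> t \<le> Suc q"
      using chord_pairsD[of t 2] chord_pairsD[of 2 t] by auto
    from t obtain x y where xy: "(x, y) \<in> chord_pairs" "{x, y} = {2, t}" by auto
    have "(1, Suc a) \<noteq> (a, Suc q)" "(1, Suc a) \<noteq> (x, y)" "(a, Suc q) \<noteq> (x, y)"
      using xy(2) c by (auto simp: doubleton_eq_iff)
    from three_chords(2)[OF 1 2 xy(1) this] have "s \<in> {1, Suc a, a, Suc q} \<union> {x, y}" if "endpoint s" for s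
      using that by blast
    then have no: "\<not> endpoint s" if "3 \<le> s" "s < a" "s \<noteq> t" for s
      using that c unfolding xy(2) by fastforce
    consider "t = 0" | "t = Suc q" | "t = q" | v where "t = Suc v" "3 \<le> v" "v < a"
      using t_cases c by (cases t; force simp: le_Suc_eq)
    then have False
    proof cases
      case t': 1
      have "endpoint 3"
        by (rule endpointI[of "[0, 2, 1, q, Suc q] @ dn 3 a"])
          (use E_close D1 D2 c Et t' in \<open>auto simp: path_simps\<close>)
      moreover have "\<not> endpoint 3" by (rule no) (use c r t' in linarith)+
      ultimately show False by blast
    next
      case t': 2
      have "endpoint r"
        by (rule endpointI[of "[0, 1, q, a, Suc q] @ up 2 r"])
          (use E_close D1 D2 c r Et t' in \<open>auto simp: path_simps\<close>)
      moreover have "\<not> endpoint r" by (rule no) (use c r t' in linarith)+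
      ultimately show False by blast
    next
      case t': 3
      have "endpoint 3"
        by (rule endpointI[of "[0, 1, 2, q, Suc q] @ dn 3 a"])
          (use E_close D1 D2 c Et t' in \<open>auto simp: path_simps\<close>)
      moreover have "\<not> endpoint 3" by (rule no) (use c r t' in linarith)+
      ultimately show False by blast
    next
      case t': 4
      have "endpoint v"
        by (rule endpointI[of "[0, 1, q, Suc q] @ dn t a @ up 2 v"])
          (use E_close D1 D2 c Et t' in \<open>auto simp: path_simps\<close>)
      moreover have "\<not> endpoint v" by (rule no) (use c r t' in linarith)+
      ultimately show False by blast
    qed
    then show ?thesis ..
  next
    case c: 6
    have 3: "(2, q) \<in> chord_pairs"
      using third_chord[OF 1 2 _ e2 eq] c by auto
    note D3 = chord_pairsD[OF 3] and th = three_chords[OF 1 2 3]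
    consider "a = 3" "q = 5" | "a = 3" "6 \<le> q" | "4 \<le> a" "q = a + 2" | "4 \<le> a" "a + 3 \<le> q"
      using c by linarith
    then show ?thesis
    proof cases
      case 1 with e show ?thesis by (auto simp: le_Suc_eq numeral_eq_Suc)
    next
      case d: 2
      have "endpoint 5"
        by (rule endpointI[of "[0, Suc q, 3, 4, 1, 2] @ dn 5 q"])
          (use E_close D1 D2 D3 d in \<open>auto simp: path_simps\<close>)
      with th(2)[of 5] d show ?thesis by auto
    next
      case d: 3
      obtain r where r: "a = Suc r" using d by (cases a) auto
      have "endpoint r"
        by (rule endpointI[of "[0, 1, Suc a, a, Suc q, q] @ up 2 r"])
          (use E_close D1 D2 D3 d r in \<open>auto simp: path_simps\<close>)
      with th(2)[of r] d r show ?thesis by auto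
    next
      case 4 with th(1) e c show ?thesis by auto
    qed
  qed
qed

text \<open>\<open>no_crossing\<close> only excludes chords from 1 and q+1 that cross and have
  consecutive other ends. Rotation makes a and b+1 endpoints. If they differ, the third chord joins
  them; if they coincide, the other end of the chord there is the free parameter.\<close>

lemma noncrossing_chords_cases:
  assumes 1: "(1, Suc a) \<in> chord_pairs" and 2: "(b, Suc q) \<in> chord_pairs" and "1 < b" "a < q"
    and no_crossing: "\<And>a. (1, Suc a) \<in> chord_pairs \<Longrightarrow> (a, Suc q) \<notin> chord_pairs"
  shows "(\<forall>s\<in>{1..Suc q}. endpoint s) \<or>
    (q = 4 \<and> chord_pairs = {(0, 3), (1, 4), (2, 5)} \<and> (\<forall>s\<in>{1, 3, 5}. endpoint s))"
proof -
  note D1 = chord_pairsD[OF 1] and D2 = chord_pairsD[OF 2]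
  have ab: "2 \<le> a" "a < q" "2 \<le> b" "b < q" "a \<noteq> b" using D1 D2 assms by auto
  note e = endpoint_1 endpoint_Suc_q endpoint_before[OF 1] endpoint_after[OF 2]
  consider "a < b" | "Suc b < a" | "a = Suc b" using ab by linarith
  then show ?thesis
  proof cases
    case c: 1
    have 3: "(a, Suc b) \<in> chord_pairs"
      using third_chord[OF 1 2 _ e(3,4)] c ab by auto
    note D3 = chord_pairsD[OF 3] and th = three_chords(2)[OF 1 2 3]
    have eq: "endpoint q"
      by (rule endpointI[of "[0, Suc q] @ dn (Suc a) b @ up 1 a @ up (Suc b) q"])
        (use E_close D1 D2 D3 ab c in \<open>auto simp: path_simps\<close>)
    have e2: "endpoint 2"
      by (rule endpointI[of "[0, 1] @ up (Suc a) b @ dn (Suc b) (Suc q) @ dn 2 a"])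
        (use E_close D1 D2 D3 ab c in \<open>auto simp: path_simps\<close>)
    have *: "a = 2" "q = Suc b"
      using th[OF _ _ _ e2] th[OF _ _ _ eq] ab c by auto
    have e3: "endpoint 3"
      by (rule endpointI[of "0 # up 1 a @ up (Suc b) (Suc q) @ dn 3 b"])
        (use E_close D1 D2 D3 ab c * in \<open>auto simp: path_simps\<close>)
    consider "b = 3" | "b = 4" | "5 \<le> b" using c ab by linarith
    then show ?thesis
    proof cases
      case 1 with e e2 eq * e3 show ?thesis by (auto simp: le_Suc_eq numeral_eq_Suc)
    next
      case d: 2
      have "endpoint b"
        by (rule endpointI[of "0 # dn (Suc b) (Suc q) @ dn 1 a @ up (Suc a) b"])
          (use E_close D1 D2 D3 ab c * in \<open>auto simp: path_simps\<close>)
      with d e e2 eq * e3 show ?thesis by (auto simp: le_Suc_eq numeral_eq_Suc)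
    next
      case d: 3
      have "endpoint 4"
        by (rule endpointI[of "[0, 1, 3, 2, q, Suc q] @ dn 4 b"])
          (use E_close D1 D2 D3 ab c d * in \<open>auto simp: path_simps\<close>)
      with th[of 4] d * show ?thesis by auto
    qed
  next
    case c: 2
    have 3: "(Suc b, a) \<in> chord_pairs"
      using third_chord[OF 1 2 _ e(4,3)] c ab by auto
    note D3 = chord_pairsD[OF 3]
    have "endpoint (Suc (Suc b))"
      by (rule endpointI[of "0 # dn (Suc a) (Suc q) @ up 1 (Suc b) @ dn (Suc (Suc b)) a"])
        (use E_close D1 D2 D3 ab c in \<open>auto simp: path_simps\<close>)
    from three_chords(2)[OF 1 2 3 _ _ _ this] D3 ab show ?thesis by auto
  next
    case c: 3
    define m where "m = Suc b"
    have m: "a = m" "Suc m \<le> q" "3 \<le> m" using c ab m_def by auto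
    have m1: "(1, Suc m) \<in> chord_pairs" using 1 m by simp
    obtain t where t: "(m, t) \<in> chord_pairs \<or> (t, m) \<in> chord_pairs" using chorded e m by blast
    \<comment> \<open>By \<open>no_crossing\<close>, the chord at m goes neither to 1 nor to q+1.
      Positive ends below m and ends above m are mirror images; the end 0 gives the complete
      bipartite graph.\<close>
    have t1: "(1, m) \<notin> chord_pairs" using no_crossing[of b] 2 m_def by auto
    have t2: "(m, Suc q) \<notin> chord_pairs" using no_crossing[of m] m1 by auto
    consider "(0, m) \<in> chord_pairs" | "(t, m) \<in> chord_pairs" "2 \<le> t" "t < b" 
      | v where "(m, Suc v) \<in> chord_pairs" "Suc m \<le> v" "v < q"
    proof -
      assume *: "(0, m) \<in> chord_pairs \<Longrightarrow> thesis" "(t, m) \<in> chord_pairs \<Longrightarrow> 2 \<le> t \<Longrightarrow> t < b \<Longrightarrow> thesis"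
        "\<And>v. (m, Suc v) \<in> chord_pairs \<Longrightarrow> Suc m \<le> v \<Longrightarrow> v < q \<Longrightarrow> thesis"
      from t show thesis
      proof
        assume "(m, t) \<in> chord_pairs"
        then show thesis using chord_pairsD[of m t] t2 * by (cases t; cases "t = Suc q") auto
      next
        assume t: "(t, m) \<in> chord_pairs"
        then show thesis using chord_pairsD[of t m] t1 * m_def by (cases "t = 0"; cases "t = 1") auto
      qed
    qed
    then show ?thesis
    proof cases
      case 3: 1
      note D3 = chord_pairsD[OF 3] and th = three_chords[OF 1 2 3]
      obtain r where r: "b = Suc r" using ab by (cases b) auto
      have "endpoint r"
        by (rule endpointI[of "[0, m, b] @ dn (Suc m) (Suc q) @ up 1 r"])
          (use E_close D1 D2 D3 ab m m_def r in \<open>auto simp: path_simps\<close>)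
      from th(2)[OF _ _ _ this] have "r = 1" using r m_def ab m by auto
      have "endpoint (Suc (Suc m))"
        by (rule endpointI[of "[0, m, Suc m] @ up 1 b @ dn (Suc (Suc m)) (Suc q)"])
          (use E_close D1 D2 D3 ab m m_def r in \<open>auto simp: path_simps\<close>)
      from th(2)[OF _ _ _ this] have "Suc m = q" using r m_def ab m by auto
      show ?thesis
        using th(1) e m m_def r \<open>r = 1\<close> \<open>Suc m = q\<close> by (auto simp: numeral_eq_Suc)
    next
      case d: 2
      note D3 = chord_pairsD[OF d(1)] and th = three_chords(2)[OF 1 2 d(1)]
      have et: "endpoint (Suc t)"
        by (rule endpointI[of "0 # dn (Suc m) (Suc q) @ up 1 t @ dn (Suc t) m"])
          (use E_close D1 D2 D3 ab m m_def d in \<open>auto simp: path_simps\<close>)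
      have "Suc t = b" using th[OF _ _ _ et] d m m_def ab by auto
      have eq: "endpoint q"
        by (rule endpointI[of "[0, Suc q, b, m] @ dn 1 t @ up (Suc m) q"])
          (use E_close D1 D2 D3 ab m m_def d \<open>Suc t = b\<close> in \<open>auto simp: path_simps\<close>)
      have "q = Suc m" using th[OF _ _ _ eq] d m m_def ab by auto
      have e2: "endpoint 2"
        by (rule endpointI[of "[0, 1, Suc m, Suc q, b, m] @ dn 2 t"])
          (use E_close D1 D2 D3 ab m m_def d \<open>Suc t = b\<close> \<open>q = Suc m\<close> in \<open>auto simp: path_simps\<close>)
      have "t = 2" using th[OF _ _ _ e2] d m m_def ab by auto
      with e et eq e2 \<open>q = Suc m\<close> \<open>Suc t = b\<close> m m_def show ?thesis
        by (auto simp: le_Suc_eq numeral_eq_Suc)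
    next
      case d: 3
      note D3 = chord_pairsD[OF d(1)] and th = three_chords(2)[OF 1 2 d(1)]
      have ev: "endpoint v"
        by (rule endpointI[of "0 # up 1 b @ dn (Suc v) (Suc q) @ up m v"])
          (use E_close D1 D2 D3 ab m m_def d in \<open>auto simp: path_simps\<close>)
      have "v = Suc m" using th[OF _ _ _ ev] d m m_def ab by auto
      have e2: "endpoint 2"
        by (rule endpointI[of "[0, 1, Suc m, m] @ up (Suc v) (Suc q) @ dn 2 b"])
          (use E_close D1 D2 D3 ab m m_def d \<open>v = Suc m\<close> in \<open>auto simp: path_simps\<close>)
      have "b = 2" using th[OF _ _ _ e2] d m m_def ab by auto
      have eq: "endpoint q"
        by (rule endpointI[of "[0, Suc q, b, 1, Suc m, m] @ up (Suc v) q"])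
          (use E_close D1 D2 D3 ab m m_def d \<open>v = Suc m\<close> \<open>b = 2\<close> in \<open>auto simp: path_simps\<close>)
      have "q = Suc v" using th[OF _ _ _ eq] d m m_def ab by auto
      with e ev eq e2 \<open>v = Suc m\<close> \<open>b = 2\<close> m m_def show ?thesis
        by (auto simp: le_Suc_eq numeral_eq_Suc)
    qed
  qed
qed

text \<open>The endpoints 1 and q+1 both carry chords. The split is by whether these can be one and
  the same chord, can cross with consecutive other ends, or neither.\<close>

lemma lollipop_cases:
  obtains "\<forall>s\<in>{1..Suc q}. endpoint s"
  | "q = 4" "chord_pairs = {(0, 3), (1, 4), (2, 5)}" "\<forall>s\<in>{1, 3, 5}. endpoint s"
  | a where "4 \<le> a" "a + 3 \<le> q" "chord_pairs = {(1, Suc a), (a, Suc q), (2, q)}"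
      "\<forall>s\<in>{1, 2, a, Suc a, q, Suc q}. endpoint s"
proof (cases "(1, Suc q) \<in> chord_pairs")
  case True
  from that(1)[OF all_endpoints_if_root_triangle[OF this]] show ?thesis .
next
  case False
  obtain t where "(1, t) \<in> chord_pairs \<or> (t, 1) \<in> chord_pairs" using chorded endpoint_1 by blast
  then have t: "(1, t) \<in> chord_pairs" using chord_pairsD[of t 1] by auto
  then obtain a where a: "(1, Suc a) \<in> chord_pairs" by (cases t) (auto dest: chord_pairsD)
  obtain b where "(b, Suc q) \<in> chord_pairs \<or> (Suc q, b) \<in> chord_pairs" using chorded endpoint_Suc_q by blast
  then have b: "(b, Suc q) \<in> chord_pairs" using chord_pairsD[of "Suc q" b] by auto
  have "b \<noteq> 0" using chord_pairsD[OF b] by simp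
  moreover have "b \<noteq> 1" using False b by blast
  ultimately have "1 < b" by simp
  have "a \<noteq> q" using False a by blast
  then have "a < q" using chord_pairsD[OF a] by simp
  show ?thesis
  proof (cases "\<exists>a. (1, Suc a) \<in> chord_pairs \<and> (a, Suc q) \<in> chord_pairs")
    case True
    then obtain c where c: "(1, Suc c) \<in> chord_pairs" "(c, Suc q) \<in> chord_pairs" by blast
    from crossing_chords_cases[OF c] show ?thesis
      by (elim disjE conjE) (rule that; assumption)+
  next
    case no_crossing: False
    have "(\<forall>s\<in>{1..Suc q}. endpoint s) \<or>
      (q = 4 \<and> chord_pairs = {(0, 3), (1, 4), (2, 5)} \<and> (\<forall>s\<in>{1, 3, 5}. endpoint s))"
      by (rule noncrossing_chords_cases[OF a b \<open>1 < b\<close> \<open>a < q\<close>]) (use no_crossing in blast)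
    then show ?thesis
      by (elim disjE conjE) (rule that; assumption)+
  qed
qed

end

section \<open>Critical graphs\<close>

definition hexagon_colourable :: "nat \<Rightarrow> nat \<Rightarrow> nat \<Rightarrow> nat \<Rightarrow> nat \<Rightarrow> nat \<Rightarrow> bool" where
  "hexagon_colourable f1 f2 f3 f4 f5 f6 \<longleftrightarrow> (\<exists>c1 c2 c3 c4 c5 c6.
    c1 < 3 \<and> c2 < 3 \<and> c3 < 3 \<and> c4 < 3 \<and> c5 < 3 \<and> c6 < 3 \<and>
    c1 \<noteq> f1 \<and> c2 \<noteq> f2 \<and> c3 \<noteq> f3 \<and> c4 \<noteq> f4 \<and> c5 \<noteq> f5 \<and> c6 \<noteq> f6 \<and>
    c1 \<noteq> c2 \<and> c2 \<noteq> c3 \<and> c3 \<noteq> c4 \<and> c4 \<noteq> c5 \<and> c5 \<noteq> c6 \<and> c6 \<noteq> c1)"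

lemma hexagon_colourableI:
  assumes "c1 < 3" "c2 < 3" "c3 < 3" "c4 < 3" "c5 < 3" "c6 < 3"
    "c1 \<noteq> f1" "c2 \<noteq> f2" "c3 \<noteq> f3" "c4 \<noteq> f4" "c5 \<noteq> f5" "c6 \<noteq> f6"
    "c1 \<noteq> c2" "c2 \<noteq> c3" "c3 \<noteq> c4" "c4 \<noteq> c5" "c5 \<noteq> c6" "c6 \<noteq> c1"
  shows "hexagon_colourable f1 f2 f3 f4 f5 f6"
  unfolding hexagon_colourable_def
  by (intro exI[of _ c1] exI[of _ c2] exI[of _ c3] exI[of _ c4] exI[of _ c5] exI[of _ c6] conjI assms)

lemma hexagon_colourable_rotate:
  "hexagon_colourable f2 f3 f4 f5 f6 f1 \<Longrightarrow> hexagon_colourable f1 f2 f3 f4 f5 f6"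
  unfolding hexagon_colourable_def[of f2] by (elim exE conjE) (rule hexagon_colourableI)

text \<open>The first vertex receives \<open>f6\<close>, which is allowed there but forbidden at the
  last. Greedy choice along the cycle then meets only two constraints at each vertex, as the last
  one avoids \<open>f6\<close> anyway.\<close>

lemma hexagon_colourable_if_neq:
  assumes "f1 \<noteq> f6" "f6 < 3"
  shows "hexagon_colourable f1 f2 f3 f4 f5 f6"
proof -
  have free: "\<exists>z<3::nat. z \<noteq> x \<and> z \<noteq> y" for x y :: nat
  proof -
    have "card ({..<3} - {x, y}) \<ge> 3 - card {x, y}"
      using diff_card_le_card_Diff[of "{x, y}" "{..<3::nat}"] by simp
    moreover have "card {x, y} \<le> 2" by (simp add: card_insert_if)
    ultimately have "{..<3} - {x, y} \<noteq> {}" by (intro notI) simp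
    then show ?thesis by blast
  qed
  obtain c2 where c2: "c2 < 3" "c2 \<noteq> f2" "c2 \<noteq> f6" using free by blast
  obtain c3 where c3: "c3 < 3" "c3 \<noteq> f3" "c3 \<noteq> c2" using free by blast
  obtain c4 where c4: "c4 < 3" "c4 \<noteq> f4" "c4 \<noteq> c3" using free by blast
  obtain c5 where c5: "c5 < 3" "c5 \<noteq> f5" "c5 \<noteq> c4" using free by blast
  obtain c6 where c6: "c6 < 3" "c6 \<noteq> f6" "c6 \<noteq> c5" using free by blast
  show ?thesis
    by (rule hexagon_colourableI[of f6 c2 c3 c4 c5 c6];
      (rule assms c2 c3 c4 c5 c6 | rule not_sym, rule assms c2 c3 c4 c5 c6))
qed

text \<open>If two consecutive forbidden colours differ, rotate that place to the front; otherwise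
  all six agree, and the two other colours alternate because the cycle is even.\<close>

lemma hexagon_list_colouring:
  assumes f: "f1 < 3" "f2 < 3" "f3 < 3" "f4 < 3" "f5 < 3" "f6 < 3"
  shows "hexagon_colourable f1 f2 f3 f4 f5 f6"
proof -
  note r = hexagon_colourable_rotate and n = hexagon_colourable_if_neq
  consider "f1 \<noteq> f6" | "f2 \<noteq> f1" | "f3 \<noteq> f2" | "f4 \<noteq> f3" | "f5 \<noteq> f4"
    | "f1 = f6" "f2 = f6" "f3 = f6" "f4 = f6" "f5 = f6" by metis
  then show ?thesis
  proof cases
    case 1 then show ?thesis by (rule n) fact
  next
    case 2 show ?thesis by (rule r, rule n) fact+
  next
    case 3 show ?thesis by (rule r, rule r, rule n) fact+
  next
    case 4 show ?thesis by (rule r, rule r, rule r, rule n) fact+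
  next
    case 5 show ?thesis by (rule r, rule r, rule r, rule r, rule n) fact+
  next
    case 6
    obtain x y :: nat where xy: "x < 3" "y < 3" "x \<noteq> y" "x \<noteq> f6" "y \<noteq> f6"
    proof -
      assume *: "\<And>x y :: nat. x < 3 \<Longrightarrow> y < 3 \<Longrightarrow> x \<noteq> y \<Longrightarrow> x \<noteq> f6 \<Longrightarrow> y \<noteq> f6 \<Longrightarrow> thesis"
      have "f6 = 0 \<or> f6 = 1 \<or> f6 = 2" using f(6) by auto
      then show thesis using *[of 0 1] *[of 0 2] *[of 1 2] by auto
    qed
    show ?thesis unfolding 6
      by (rule hexagon_colourableI[of x y x y x y]; (rule xy | rule not_sym, rule xy))
  qed
qed

section \<open>Structure of vertex-critical graphs\<close>

definition three_colouring :: "('a \<Rightarrow> 'a \<Rightarrow> bool) \<Rightarrow> 'a set \<Rightarrow> ('a \<Rightarrow> nat) \<Rightarrow> bool" where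
  "three_colouring adj A c \<longleftrightarrow>
    (\<forall>v\<in>A. c v < 3) \<and> (\<forall>u\<in>A. \<forall>v\<in>A. adj u v \<longrightarrow> c u \<noteq> c v)"

text \<open>The graph induced on \<open>W\<close> is 4-vertex-critical. Stating
  \<open>minimal\<close> for all proper subsets allows a hexagon or one side of a cut to be removed
  at once.\<close>

locale critical_graph =
  fixes adj :: "'a \<Rightarrow> 'a \<Rightarrow> bool" and W :: "'a set"
  assumes finite_W: "finite W"
    and irrefl: "\<not> adj v v"
    and sym: "adj u v \<Longrightarrow> adj v u"
    and not_colourable: "\<not> three_colouring adj W c"
    and minimal: "A \<subset> W \<Longrightarrow> \<exists>c. three_colouring adj A c"
begin

text \<open>A colour missing among the neighbours could be given to \<open>v\<close>.\<close>

lemma all_colours_at: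
  assumes "v \<in> W" "three_colouring adj (W - {v}) c" "k < 3"
  shows "\<exists>u\<in>W. adj v u \<and> c u = k"
proof (rule ccontr)
  assume "\<not> ?thesis"
  then have "three_colouring adj W (c(v := k))"
    using assms irrefl sym by (auto simp: three_colouring_def)
  with not_colourable show False by blast
qed

lemma degree:
  assumes "v \<in> W" shows "3 \<le> card {u\<in>W. adj v u}"
proof -
  obtain c where "three_colouring adj (W - {v}) c"
    using minimal[of "W - {v}"] assms by blast
  from all_colours_at[OF assms this] have "{..<3} \<subseteq> c ` {u\<in>W. adj v u}"
    by auto
  from surj_card_le[OF _ this] finite_W show ?thesis by simp
qed

text \<open>Otherwise a 3-colouring of \<open>W - {u}\<close> would extend by giving
  \<open>u\<close> the colour of \<open>v\<close>.\<close>

lemma no_dominated_vertex: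
  assumes "u \<in> W" "v \<in> W" "u \<noteq> v"
  shows "\<exists>w\<in>W. adj u w \<and> \<not> adj v w"
proof (rule ccontr)
  assume *: "\<not> ?thesis"
  obtain c where c: "three_colouring adj (W - {u}) c"
    using minimal[of "W - {u}"] assms by blast
  then have "c v < 3" using assms by (auto simp: three_colouring_def)
  from all_colours_at[OF \<open>u \<in> W\<close> c this] obtain w where w: "w \<in> W" "adj u w" "c w = c v" by blast
  then have "adj v w" "w \<noteq> u" using * irrefl by auto
  with c assms w(1) have "c v \<noteq> c w" by (auto simp: three_colouring_def)
  with w(3) show False by simp
qed

text \<open>By \<open>closed\<close>, only r joins A to the rest. Both sides, each taken with r, are
  3-colourable by minimality, the vertex \<open>a\<close> making the second side a proper subset.
  Swapping two colours on that side makes the colourings agree at r.\<close>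

lemma no_cut_vertex:
  assumes "A \<subseteq> W" "r \<in> A" "a \<in> A" "a \<noteq> r"
    and closed: "\<And>u v. u \<in> A \<Longrightarrow> u \<noteq> r \<Longrightarrow> v \<in> W \<Longrightarrow> adj u v \<Longrightarrow> v \<in> A"
  shows "A = W"
proof (rule ccontr)
  assume "A \<noteq> W"
  define B where "B = insert r (W - A)"
  obtain c d where c: "three_colouring adj A c" and d: "three_colouring adj B d"
    using minimal[of A] minimal[of B] assms \<open>A \<noteq> W\<close> unfolding B_def by blast
  define \<pi> where "\<pi> k = (if k = d r then c r else if k = c r then d r else k)" for k
  have \<pi>: "\<pi> (d r) = c r" "\<pi> k = \<pi> l \<Longrightarrow> k = l" for k l
    unfolding \<pi>_def by (auto split: if_splits)
  have "c r < 3" "d r < 3" using c d assms by (auto simp: three_colouring_def B_def)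
  then have \<pi>3: "k < 3 \<Longrightarrow> \<pi> k < 3" for k
    unfolding \<pi>_def by auto
  define e where "e v = (if v \<in> A then c v else \<pi> (d v))" for v
  have eB: "e v = \<pi> (d v)" if "v \<in> B" for v
    using that \<pi> by (auto simp: e_def B_def)
  have "e u \<noteq> e v" if "u \<in> A" "v \<in> A" "adj u v" for u v
    using c that by (auto simp: three_colouring_def e_def)
  moreover have "e u \<noteq> e v" if "u \<in> B" "v \<in> B" "adj u v" for u v
    using d that eB \<pi>(2) by (metis three_colouring_def)
  moreover have "u \<in> A \<and> v \<in> A \<or> u \<in> B \<and> v \<in> B" if "u \<in> W" "v \<in> W" "adj u v" for u v
    using closed[of u v] closed[of v u] that sym by (auto simp: B_def)
  moreover have "e v < 3" if "v \<in> W" for v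
    using c d that \<pi>3 by (auto simp: three_colouring_def e_def B_def)
  ultimately have "three_colouring adj W e"
    unfolding three_colouring_def by blast
  with not_colourable show False by blast
qed

text \<open>Remove the six vertices, colour the rest, and forbid at each hexagon vertex the colour
  of its only possible outside neighbour. The outside neighbours may coincide.\<close>

lemma no_cubic_hexagon:
  assumes W: "{v1, v2, v3, v4, v5, v6} \<subseteq> W" and dist: "distinct [v1, v2, v3, v4, v5, v6]"
    and w: "{w1, w2, w3, w4, w5, w6} \<subseteq> W - {v1, v2, v3, v4, v5, v6}"
    and N: "\<And>u. u \<in> W \<Longrightarrow> adj v1 u \<Longrightarrow> u \<in> {v6, v2, w1}"
      "\<And>u. u \<in> W \<Longrightarrow> adj v2 u \<Longrightarrow> u \<in> {v1, v3, w2}"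
      "\<And>u. u \<in> W \<Longrightarrow> adj v3 u \<Longrightarrow> u \<in> {v2, v4, w3}"
      "\<And>u. u \<in> W \<Longrightarrow> adj v4 u \<Longrightarrow> u \<in> {v3, v5, w4}"
      "\<And>u. u \<in> W \<Longrightarrow> adj v5 u \<Longrightarrow> u \<in> {v4, v6, w5}"
      "\<And>u. u \<in> W \<Longrightarrow> adj v6 u \<Longrightarrow> u \<in> {v5, v1, w6}"
  shows False
proof -
  let ?H = "{v1, v2, v3, v4, v5, v6}"
  obtain c where c: "three_colouring adj (W - ?H) c"
    using minimal[of "W - ?H"] W by blast
  have "c w1 < 3" "c w2 < 3" "c w3 < 3" "c w4 < 3" "c w5 < 3" "c w6 < 3"
    using c w by (auto simp: three_colouring_def)
  from hexagon_list_colouring[OF this, unfolded hexagon_colourable_def] obtain c1 c2 c3 c4 c5 c6 where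
    lt: "c1 < 3" "c2 < 3" "c3 < 3" "c4 < 3" "c5 < 3" "c6 < 3" and
    neq: "c1 \<noteq> c w1" "c2 \<noteq> c w2" "c3 \<noteq> c w3" "c4 \<noteq> c w4" "c5 \<noteq> c w5" "c6 \<noteq> c w6"
      "c1 \<noteq> c2" "c2 \<noteq> c3" "c3 \<noteq> c4" "c4 \<noteq> c5" "c5 \<noteq> c6" "c6 \<noteq> c1"
    by blast
  define e where "e = c(v1 := c1, v2 := c2, v3 := c3, v4 := c4, v5 := c5, v6 := c6)"
  have ev: "e v1 = c1" "e v2 = c2" "e v3 = c3" "e v4 = c4" "e v5 = c5" "e v6 = c6"
    using dist by (auto simp: e_def)
  have eo: "e u = c u" if "u \<notin> ?H" for u
    using that by (auto simp: e_def)
  have ew: "e w1 = c w1" "e w2 = c w2" "e w3 = c w3" "e w4 = c w4" "e w5 = c w5" "e w6 = c w6"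
    using w by (auto intro!: eo)
  have H: "e u \<noteq> e v" if "u \<in> ?H" "v \<in> W" "adj u v" for u v
    using that(1)
  proof (elim insertE emptyE)
    assume u: "u = v1"
    with N(1)[OF that(2)] that(3) have "v = v6 \<or> v = v2 \<or> v = w1" by simp
    then show ?thesis unfolding u ev
      by (elim disjE) (simp_all only: ev ew neq neq[THEN not_sym] not_False_eq_True)
  next
    assume u: "u = v2"
    with N(2)[OF that(2)] that(3) have "v = v1 \<or> v = v3 \<or> v = w2" by simp
    then show ?thesis unfolding u ev
      by (elim disjE) (simp_all only: ev ew neq neq[THEN not_sym] not_False_eq_True)
  next
    assume u: "u = v3"
    with N(3)[OF that(2)] that(3) have "v = v2 \<or> v = v4 \<or> v = w3" by simp
    then show ?thesis unfolding u ev
      by (elim disjE) (simp_all only: ev ew neq neq[THEN not_sym] not_False_eq_True)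
  next
    assume u: "u = v4"
    with N(4)[OF that(2)] that(3) have "v = v3 \<or> v = v5 \<or> v = w4" by simp
    then show ?thesis unfolding u ev
      by (elim disjE) (simp_all only: ev ew neq neq[THEN not_sym] not_False_eq_True)
  next
    assume u: "u = v5"
    with N(5)[OF that(2)] that(3) have "v = v4 \<or> v = v6 \<or> v = w5" by simp
    then show ?thesis unfolding u ev
      by (elim disjE) (simp_all only: ev ew neq neq[THEN not_sym] not_False_eq_True)
  next
    assume u: "u = v6"
    with N(6)[OF that(2)] that(3) have "v = v5 \<or> v = v1 \<or> v = w6" by simp
    then show ?thesis unfolding u ev
      by (elim disjE) (simp_all only: ev ew neq neq[THEN not_sym] not_False_eq_True)
  qed
  have "e u \<noteq> e v" if "u \<in> W" "v \<in> W" "adj u v" for u v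
  proof (cases "u \<in> ?H \<or> v \<in> ?H")
    case True
    with H[of u v] H[of v u] that sym show ?thesis by metis
  next
    case False
    with c that eo[of u] eo[of v] show ?thesis by (auto simp: three_colouring_def)
  qed
  moreover have "e v < 3" if "v \<in> W" for v
  proof (cases "v \<in> ?H")
    case True with ev lt show ?thesis by auto
  next
    case False with c that eo[of v] show ?thesis by (auto simp: three_colouring_def)
  qed
  ultimately have "three_colouring adj W e"
    unfolding three_colouring_def by blast
  with not_colourable show False by blast
qed

subsection \<open>Longest paths\<close>

text \<open>A Hamiltonian path of the cycle from its root, reversed and continued along the rest of
  the longest path, is again a longest path. It cannot be prolonged, so all neighbours of its first
  vertex lie on it, and by the extremal choice none of them beyond the cycle.\<close>

lemma longest_path_lollipop:
  obtains C q where "length C = Suc (Suc q)" "2 \<le> q" "distinct C" "set C \<subseteq> W"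
    "\<And>i. i \<le> q \<Longrightarrow> adj (C ! i) (C ! Suc i)" "adj (C ! 0) (C ! Suc q)"
    "\<And>ys v. successively (\<lambda>i j. adj (C ! i) (C ! j)) ys \<Longrightarrow> distinct ys \<Longrightarrow> set ys = {0..Suc q} \<Longrightarrow>
       hd ys = 0 \<Longrightarrow> v \<in> W \<Longrightarrow> adj (C ! last ys) v \<Longrightarrow> v \<in> set C"
proof -
  define path where "path xs \<longleftrightarrow> xs \<noteq> [] \<and> distinct xs \<and> set xs \<subseteq> W \<and> successively adj xs" for xs
  have "three_colouring adj {} (\<lambda>_. 0)" by (simp add: three_colouring_def)
  with not_colourable obtain w where "w \<in> W" by (cases "W = {}") auto
  then have "path [w]" by (simp add: path_def)
  have "length xs \<le> card W" if "path xs" for xs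
    using that finite_W card_mono distinct_card unfolding path_def by metis
  with \<open>path [w]\<close> obtain zs where zs: "path zs" "\<And>xs. path xs \<Longrightarrow> length xs \<le> length zs"
    using ex_has_greatest_nat[of path "[w]" length "Suc (card W)"] by (metis less_Suc_eq_le)
  define n where "n = length zs"
  have end_nbrs: "v \<in> set xs" if "path xs" "length xs = n" "v \<in> W" "adj (hd xs) v" for xs v
  proof (rule ccontr)
    assume "v \<notin> set xs"
    with that sym have "path (v # xs)" by (cases xs) (auto simp: path_def)
    from zs(2)[OF this] that show False by (simp add: n_def)
  qed
  \<comment> \<open>Positions are collected over all longest paths, so that their maximum also
    bounds the neighbours of the first vertex of a rerouted path.\<close>
  define J where "J = {j. \<exists>xs. path xs \<and> length xs = n \<and> j < n \<and> adj (hd xs) (xs ! j)}"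
  have "finite J" by (rule finite_subset[of _ "{..<n}"]) (auto simp: J_def)
  have inJ: "\<exists>j\<in>J. j < n \<and> v = xs ! j" if "path xs" "length xs = n" "v \<in> W" "adj (hd xs) v" for xs v
    using end_nbrs[OF that] that unfolding J_def by (auto simp: in_set_conv_nth)
  have hdW: "hd xs \<in> W" if "path xs" for xs
    using that by (auto simp: path_def)
  have "J \<noteq> {}"
  proof -
    have "card {u\<in>W. adj (hd zs) u} \<noteq> 0" using degree[OF hdW[OF zs(1)]] by simp
    then obtain v where "v \<in> W" "adj (hd zs) v" by (metis (mono_tags, lifting) card_eq_0_iff empty_Collect_eq)
    with inJ[OF zs(1)] show ?thesis by (auto simp: n_def)
  qed
  define j where "j = Max J"
  have "j \<in> J" unfolding j_def using \<open>finite J\<close> \<open>J \<noteq> {}\<close> by simp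
  then obtain xs where xs: "path xs" "length xs = n" "j < n" "adj (hd xs) (xs ! j)"
    by (auto simp: J_def)
  have hd: "hd xs = xs ! 0" using xs by (auto simp: path_def hd_conv_nth)
  have nbrs: "\<exists>i\<le>j. v = ys ! i" if "path ys" "length ys = n" "v \<in> W" "adj (hd ys) v" for ys v
    using inJ[OF that] \<open>finite J\<close> unfolding j_def by (metis Max_ge)
  \<comment> \<open>The first vertex has at least three neighbours, all at positions 1 to j; hence
    the cycle has at least four vertices.\<close>
  have "3 \<le> j"
  proof -
    have "{u\<in>W. adj (hd xs) u} \<subseteq> (\<lambda>i. xs ! i) ` {1..j}"
    proof
      fix v assume v: "v \<in> {u\<in>W. adj (hd xs) u}"
      then obtain i where i: "i \<le> j" "v = xs ! i" using nbrs[OF xs(1,2)] by blast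
      with v irrefl hd have "i \<noteq> 0" by (cases i) auto
      with i show "v \<in> (\<lambda>i. xs ! i) ` {1..j}" by auto
    qed
    then have "card {u\<in>W. adj (hd xs) u} \<le> card ((\<lambda>i. xs ! i) ` {1..j})"
      by (intro card_mono) auto
    also have "\<dots> \<le> j" using card_image_le[of "{1..j}" "\<lambda>i. xs ! i"] by simp
    finally show ?thesis using degree[OF hdW[OF xs(1)]] by simp
  qed
  then obtain q where q: "j = Suc q" "2 \<le> q" by (cases j) auto
  \<comment> \<open>The root is put first to get index 0; position i < j of the path becomes index
    i+1.\<close>
  define C where "C = xs ! j # take j xs"
  have C0: "C ! 0 = xs ! j" and CS: "i < j \<Longrightarrow> C ! Suc i = xs ! i" for i
    by (simp_all add: C_def)
  have setC: "set C = set (take (Suc j) xs)"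
    using xs by (auto simp: C_def take_Suc_conv_app_nth)
  have "distinct (take (Suc j) xs)" using xs by (simp add: path_def)
  then have distC: "distinct C"
    using xs by (simp add: C_def take_Suc_conv_app_nth)
  show thesis
  proof (rule that[of C q])
    show "length C = Suc (Suc q)" using xs q by (simp add: C_def)
    show "2 \<le> q" by fact
    show "distinct C" by fact
    show "set C \<subseteq> W"
      unfolding setC using xs set_take_subset[of "Suc j" xs] by (auto simp: path_def)
    show "adj (C ! i) (C ! Suc i)" if "i \<le> q" for i
    proof (cases i)
      case 0
      with xs hd sym CS[of 0] C0 q show ?thesis by auto
    next
      case (Suc k)
      with that q xs CS[of k] CS[of "Suc k"] show ?thesis
        by (auto simp: path_def successively_conv_nth)
    qed
    show "adj (C ! 0) (C ! Suc q)"
      using C0 CS[of q] q xs sym by (auto simp: path_def successively_conv_nth)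
  next
    fix ys v
    assume ys: "successively (\<lambda>i j. adj (C ! i) (C ! j)) ys" "distinct ys" "set ys = {0..Suc q}"
      "hd ys = 0" and v: "v \<in> W" "adj (C ! last ys) v"
    \<comment> \<open>The rerouted path: first the cycle vertices, ending at the root, then the old
      tail.\<close>
    define zs where "zs = rev (map ((!) C) ys) @ drop (Suc j) xs"
    have ne: "ys \<noteq> []" using ys by auto
    have lenC: "length C = Suc j" using xs by (simp add: C_def)
    have setys: "set (map ((!) C) ys) = set C"
      using ys(3) q lenC nth_image[of "Suc j" C] by (auto simp: atLeast0AtMost lessThan_Suc_atMost[symmetric] atLeast0LessThan image_iff in_set_conv_nth less_Suc_eq_le)
    have len: "length ys = Suc j" using distinct_card[OF ys(2)] ys(3) q by simp
    have "path zs"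
      unfolding path_def
    proof (intro conjI)
      show "zs \<noteq> []" using ne by (simp add: zs_def)
      have "inj_on ((!) C) {0..Suc q}" 
        using distC lenC q by (auto simp: inj_on_def nth_eq_iff_index_eq)
      then have "distinct (map ((!) C) ys)" using ys by (simp add: distinct_map)
      moreover have "set C \<inter> set (drop (Suc j) xs) = {}"
        unfolding setC using xs set_take_disj_set_drop_if_distinct[of xs "Suc j" "Suc j"] by (auto simp: path_def)
      ultimately show "distinct zs"
        using xs setys by (auto simp: zs_def path_def)
      show "set zs \<subseteq> W"
        using xs setys setC set_take_subset[of "Suc j" xs] set_drop_subset[of "Suc j" xs]
        by (auto simp: zs_def path_def)
      have "successively adj (rev (map ((!) C) ys))"
        using ys(1) sym by (auto simp: successively_map successively_rev elim: successively_mono)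
      moreover have "successively adj (drop (Suc j) xs)"
        using xs by (auto simp: path_def successively_conv_nth)
      moreover have "adj (xs ! j) (hd (drop (Suc j) xs))" if "drop (Suc j) xs \<noteq> []"
        using that xs by (auto simp: path_def successively_conv_nth hd_drop_conv_nth)
      ultimately show "successively adj zs"
        using ne ys(4) C0 by (auto simp: zs_def successively_append_iff last_rev hd_map)
    qed
    moreover have "length zs = n" using len xs by (simp add: zs_def)
    moreover have "hd zs = C ! last ys" using ne by (simp add: zs_def hd_rev last_map)
    ultimately obtain i where i: "i \<le> j" "v = zs ! i" using nbrs v by metis
    then have "v = rev (map ((!) C) ys) ! i" using len by (simp add: zs_def nth_append)
    then have "v \<in> set (rev (map ((!) C) ys))" using i len by (metis length_map length_rev less_Suc_eq_le nth_mem)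
    then show "v \<in> set C" using setys by simp
  qed
qed

text \<open>With at most three chords the cycle would be a \<open>sparse_lollipop\<close>, and each
  outcome of \<open>lollipop_cases\<close> contradicts criticality or
  \<open>K4_free\<close>.\<close>

lemma many_chords:
  assumes K4_free: "\<And>a b c d. {a, b, c, d} \<subseteq> W \<Longrightarrow> distinct [a, b, c, d] \<Longrightarrow>
    adj a b \<Longrightarrow> adj a c \<Longrightarrow> adj a d \<Longrightarrow> adj b c \<Longrightarrow> adj b d \<Longrightarrow> adj c d \<Longrightarrow> False"
  obtains C q where "length C = Suc (Suc q)" "2 \<le> q" "distinct C" "set C \<subseteq> W"
    "\<And>i. i \<le> q \<Longrightarrow> adj (C ! i) (C ! Suc i)" "adj (C ! 0) (C ! Suc q)"
    "4 \<le> card {(i, j). Suc (Suc i) \<le> j \<and> j \<le> Suc q \<and> (i, j) \<noteq> (0, Suc q) \<and> adj (C ! i) (C ! j)}"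
proof -
  obtain C q where C: "length C = Suc (Suc q)" "2 \<le> q" "distinct C" "set C \<subseteq> W"
    "\<And>i. i \<le> q \<Longrightarrow> adj (C ! i) (C ! Suc i)" "adj (C ! 0) (C ! Suc q)"
    and ends: "\<And>ys v. successively (\<lambda>i j. adj (C ! i) (C ! j)) ys \<Longrightarrow> distinct ys \<Longrightarrow> 
       set ys = {0..Suc q} \<Longrightarrow> hd ys = 0 \<Longrightarrow> v \<in> W \<Longrightarrow> adj (C ! last ys) v \<Longrightarrow> v \<in> set C"
    using longest_path_lollipop by metis
  interpret S: spanning_cycle q "\<lambda>i j. adj (C ! i) (C ! j)"
    using C sym by unfold_locales auto
  have inW: "C ! i \<in> W" if "i \<le> Suc q" for i
    using C that by (metis le_imp_less_Suc nth_mem subsetD)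
  have eq_iff: "C ! i = C ! j \<longleftrightarrow> i = j" if "i \<le> Suc q" "j \<le> Suc q" for i j
    using C that by (simp add: nth_eq_iff_index_eq)
  have index: "\<exists>t\<le>Suc q. v = C ! t" if "v \<in> set C" for v
    using that C(1) by (metis in_set_conv_nth less_Suc_eq_le)
  have ends': "v \<in> set C" if "S.endpoint s" "v \<in> W" "adj (C ! s) v" for s v
    using that ends unfolding S.endpoint_def by blast
  have chord: "\<exists>t. (s, t) \<in> S.chord_pairs \<or> (t, s) \<in> S.chord_pairs"
    if s: "s \<le> Suc q" and N: "\<And>v. v \<in> W \<Longrightarrow> adj (C ! s) v \<Longrightarrow> v \<in> set C" for s
  proof -
    \<comment> \<open>The cyclic predecessor and successor of \<open>s\<close>; minimum degree three
      leaves a neighbour other than these two.\<close>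
    define a where "a = (if s = 0 then Suc q else s - 1)"
    define b where "b = (if s = Suc q then 0 else Suc s)"
    have "\<not> {u\<in>W. adj (C ! s) u} \<subseteq> {C ! a, C ! b}"
    proof
      assume "{u\<in>W. adj (C ! s) u} \<subseteq> {C ! a, C ! b}"
      then have "card {u\<in>W. adj (C ! s) u} \<le> card {C ! a, C ! b}" by (intro card_mono) auto
      also have "\<dots> \<le> 2" by (simp add: card_insert_if)
      finally show False using degree[OF inW[OF s]] by simp
    qed
    then obtain u where u: "u \<in> W" "adj (C ! s) u" "u \<noteq> C ! a" "u \<noteq> C ! b" by blast
    then obtain t where t: "t \<le> Suc q" "u = C ! t" using N index by blast
    have "t \<noteq> a" "t \<noteq> b" "t \<noteq> s" using u t irrefl by auto
    with u t s show ?thesis using S.edge_cases[of s t] irrefl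
      by (auto simp: a_def b_def split: if_splits)
  qed
  show thesis
  proof (cases "card S.chord_pairs \<le> 3")
    case False
    then show thesis using that[OF C] unfolding S.chord_pairs_def by simp
  next
    case few: True
    interpret L: sparse_lollipop q "\<lambda>i j. adj (C ! i) (C ! j)"
      using few chord ends' S.endpoint_le by unfold_locales auto
    have N: "\<exists>t\<le>Suc q. v = C ! t \<and> (t = Suc s \<or> s = Suc t \<or> (s, t) \<in> {(0, Suc q), (Suc q, 0)} \<or>
        (s, t) \<in> S.chord_pairs \<or> (t, s) \<in> S.chord_pairs)"
      if e: "S.endpoint s" and v: "v \<in> W" "adj (C ! s) v" for s v
    proof -
      obtain t where t: "t \<le> Suc q" "v = C ! t" using index ends'[OF e v] by blast
      with S.edge_cases[of s t] S.endpoint_le[OF e] v irrefl show ?thesis by blast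
    qed
    have False
    proof (rule L.lollipop_cases)
      assume all: "\<forall>s\<in>{1..Suc q}. S.endpoint s"
      \<comment> \<open>All neighbours of a cycle vertex other than the root lie on the cycle, so a
        vertex off the cycle would make the root a cut vertex.\<close>
      have "set C = W"
      proof (rule no_cut_vertex)
        show "C ! 0 \<in> set C" "C ! 1 \<in> set C" using C by auto
        show "C ! 1 \<noteq> C ! 0" using eq_iff[of 1 0] by simp
        show "v \<in> set C" if u: "u \<in> set C" "u \<noteq> C ! 0" "v \<in> W" "adj u v" for u v
        proof -
          obtain s where s: "s \<le> Suc q" "u = C ! s" using index u by blast
          with u have "s \<in> {1..Suc q}" by (cases s) auto
          with all ends' s u show ?thesis by blast
        qed
      qed fact
      have "(q = 2 \<and> adj (C ! 0) (C ! 2) \<and> adj (C ! 1) (C ! 3)) \<or>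
        (\<exists>c::nat \<Rightarrow> nat. (\<forall>i\<le>Suc q. c i < 3) \<and>
          (\<forall>i\<le>Suc q. \<forall>j\<le>Suc q. adj (C ! i) (C ! j) \<longrightarrow> c i \<noteq> c j))"
        by (rule S.small_spanning_cycle[OF irrefl few chord]) (use \<open>set C = W\<close> in auto)
      then show False
      proof (elim disjE exE conjE)
        assume "q = 2" "adj (C ! 0) (C ! 2)" "adj (C ! 1) (C ! 3)"
        with C(5)[of 0] C(5)[of 1] C(5)[of 2] C(6) show False
          using K4_free[of "C ! 0" "C ! 1" "C ! 2" "C ! 3"] inW eq_iff
          by (simp add: numeral_eq_Suc)
      next
        fix c :: "nat \<Rightarrow> nat"
        assume c: "\<forall>i\<le>Suc q. c i < 3" "\<forall>i\<le>Suc q. \<forall>j\<le>Suc q. adj (C ! i) (C ! j) \<longrightarrow> c i \<noteq> c j"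
        obtain t where t: "\<And>v. v \<in> W \<Longrightarrow> t v \<le> Suc q \<and> v = C ! t v"
          using index \<open>set C = W\<close> by metis
        have "three_colouring adj W (\<lambda>v. c (t v))"
          unfolding three_colouring_def using c t by metis
        with not_colourable show False by blast
      qed
    next
      assume q: "q = 4" and X: "S.chord_pairs = {(0, 3), (1, 4), (2, 5)}" and e: "\<forall>s\<in>{1, 3, 5}. S.endpoint s"
      \<comment> \<open>Since 3 is an endpoint, all neighbours of \<open>C ! 3\<close> are at 0, 2
        and 4, and these are neighbours of \<open>C ! 1\<close> as well.\<close>
      have "C ! 3 \<noteq> C ! 1" using eq_iff q by simp
      then obtain w where w: "w \<in> W" "adj (C ! 3) w" "\<not> adj (C ! 1) w"
        using no_dominated_vertex[of "C ! 3" "C ! 1"] inW q by auto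
      obtain u where "w = C ! u" "u \<in> {0, 2, 4}"
        using N[OF _ w(1,2)] e q X by auto
      moreover have "adj (C ! 1) (C ! 0)" "adj (C ! 1) (C ! 2)" "adj (C ! 1) (C ! 4)"
        using S.chord_pairsD[of 1 4] X q C(5)[of 0] C(5)[of 1] sym by (auto simp: numeral_eq_Suc)
      ultimately show False using w by auto
    next
      fix a
      assume a: "4 \<le> a" "a + 3 \<le> q" and X: "S.chord_pairs = {(1, Suc a), (a, Suc q), (2, q)}"
        and e: "\<forall>s\<in>{1, 2, a, Suc a, q, Suc q}. S.endpoint s"
      obtain b r where br: "a = Suc b" "q = Suc r" using a by (cases a; cases q) auto
      define joined where "joined s t \<longleftrightarrow> t \<le> Suc q \<and> (t = Suc s \<or> s = Suc t \<or> s = 0 \<and> t = Suc q \<or> s = Suc q \<and> t = 0 \<or>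
        s = 1 \<and> t = Suc a \<or> s = Suc a \<and> t = 1 \<or> s = a \<and> t = Suc q \<or> s = Suc q \<and> t = a \<or>
        s = 2 \<and> t = q \<or> s = q \<and> t = 2)" for s t
      have nbr: "\<exists>t. u = C ! t \<and> joined s t" if "S.endpoint s" "u \<in> W" "adj (C ! s) u" for s u
        using N[OF that] unfolding X joined_def insert_iff prod.inject empty_iff by metis
      have outside: "C ! k \<in> W - {C ! 1, C ! 2, C ! q, C ! Suc q, C ! a, C ! Suc a}"
        if "k \<le> Suc q" "k \<notin> {1, 2, q, Suc q, a, Suc a}" for k
        using that a inW eq_iff[of k 1] eq_iff[of k 2] eq_iff[of k q] eq_iff[of k "Suc q"]
          eq_iff[of k a] eq_iff[of k "Suc a"] by simp
      show False
      \<comment> \<open>The hexagon alternates between cycle edges and the three chords. The outside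
        neighbours are the remaining neighbours along the cycle, 0 serving both 1 and q+1;
        \<open>4 \<le> a\<close> and \<open>a + 3 \<le> q\<close> keep them off the hexagon.\<close>
      proof (rule no_cubic_hexagon[of "C ! 1" "C ! 2" "C ! q" "C ! Suc q" "C ! a" "C ! Suc a"
            "C ! 0" "C ! 3" "C ! r" "C ! 0" "C ! b" "C ! Suc (Suc a)"])
        show "{C ! 1, C ! 2, C ! q, C ! Suc q, C ! a, C ! Suc a} \<subseteq> W"
          using inW a by simp
        show "distinct [C ! 1, C ! 2, C ! q, C ! Suc q, C ! a, C ! Suc a]"
          using a by (simp add: eq_iff)
        show "{C ! 0, C ! 3, C ! r, C ! 0, C ! b, C ! Suc (Suc a)} \<subseteq> 
          W - {C ! 1, C ! 2, C ! q, C ! Suc q, C ! a, C ! Suc a}"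
          unfolding insert_subset by (intro conjI empty_subsetI outside) (use a br in simp_all)
      next
        fix u assume "u \<in> W" "adj (C ! 1) u"
        with nbr[of 1 u] e obtain t where t: "u = C ! t" "joined 1 t" by blast
        from t(2) have "t = Suc a \<or> t = 2 \<or> t = 0"
          unfolding joined_def using a br by (elim conjE disjE; linarith)
        with t show "u \<in> {C ! Suc a, C ! 2, C ! 0}" by blast
      next
        fix u assume "u \<in> W" "adj (C ! 2) u"
        with nbr[of 2 u] e obtain t where t: "u = C ! t" "joined 2 t" by blast
        from t(2) have "t = 1 \<or> t = q \<or> t = 3"
          unfolding joined_def using a br by (elim conjE disjE; linarith)
        with t show "u \<in> {C ! 1, C ! q, C ! 3}" by blast
      next
        fix u assume "u \<in> W" "adj (C ! q) u"
        with nbr[of q u] e obtain t where t: "u = C ! t" "joined q t" by blast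
        from t(2) have "t = 2 \<or> t = Suc q \<or> t = r"
          unfolding joined_def using a br by (elim conjE disjE; linarith)
        with t show "u \<in> {C ! 2, C ! Suc q, C ! r}" by blast
      next
        fix u assume "u \<in> W" "adj (C ! Suc q) u"
        with nbr[of "Suc q" u] e obtain t where t: "u = C ! t" "joined (Suc q) t" by blast
        from t(2) have "t = q \<or> t = a \<or> t = 0"
          unfolding joined_def using a br by (elim conjE disjE; linarith)
        with t show "u \<in> {C ! q, C ! a, C ! 0}" by blast
      next
        fix u assume "u \<in> W" "adj (C ! a) u"
        with nbr[of a u] e obtain t where t: "u = C ! t" "joined a t" by blast
        from t(2) have "t = Suc q \<or> t = Suc a \<or> t = b"
          unfolding joined_def using a br by (elim conjE disjE; linarith)
        with t show "u \<in> {C ! Suc q, C ! Suc a, C ! b}" by blast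
      next
        fix u assume "u \<in> W" "adj (C ! Suc a) u"
        with nbr[of "Suc a" u] e obtain t where t: "u = C ! t" "joined (Suc a) t" by blast
        from t(2) have "t = a \<or> t = 1 \<or> t = Suc (Suc a)"
          unfolding joined_def using a br by (elim conjE disjE; linarith)
        with t show "u \<in> {C ! a, C ! 1, C ! Suc (Suc a)}" by blast
      qed
    qed
    then show thesis ..
  qed
qed

end

section \<open>From the critical subgraph back to cycles and chords of the given graph\<close>

lemma isomorphic_complete_graphI:
  assumes "finite S" "card S = n"
  shows "isomorphic (S, {{x, y} | x y. x \<in> S \<and> y \<in> S \<and> x \<noteq> y}) (complete_graph n)"
proof -
  obtain f where f: "bij_betw f S {..<n}"
    using assms finite_same_card_bij[of S "{..<n}"] by auto
  have "{f u, f v} \<in> {{i, j} | i j. i < n \<and> j < n \<and> i \<noteq> j} \<longleftrightarrow> f u \<noteq> f v" if "u \<in> S" "v \<in> S" for u v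
    using bij_betwE[OF f] that by (auto simp: doubleton_eq_iff)
  moreover have "{u, v} \<in> {{x, y} | x y. x \<in> S \<and> y \<in> S \<and> x \<noteq> y} \<longleftrightarrow> u \<noteq> v" if "u \<in> S" "v \<in> S" for u v
    using that by (auto simp: doubleton_eq_iff)
  moreover have "f u = f v \<longleftrightarrow> u = v" if "u \<in> S" "v \<in> S" for u v
    using f that by (auto simp: bij_betw_def inj_on_eq_iff)
  ultimately show ?thesis
    unfolding isomorphic_def complete_graph_def using f by (intro exI[of _ f]) auto
qed

lemma not_consecutive:
  assumes "distinct C" "Suc (Suc i) \<le> j" "j < length C" "(i, j) \<noteq> (0, length C - 1)"
  shows "\<not> consecutive C (C ! i) (C ! j)"
proof
  assume "consecutive C (C ! i) (C ! j)"
  then obtain k where k: "k < length C" "{C ! i, C ! j} = {C ! k, C ! (Suc k mod length C)}"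
    by (auto simp: consecutive_def)
  moreover have "Suc k mod length C < length C" using k by (intro mod_less_divisor) auto
  ultimately have "i = k \<and> j = Suc k mod length C \<or> i = Suc k mod length C \<and> j = k"
    using assms by (auto simp: doubleton_eq_iff nth_eq_iff_index_eq)
  with assms k show False by (auto simp: mod_Suc split: if_splits)
qed

theorem proposition1p13:
  fixes G :: "'a graph"
  assumes "finite_simple_graph G"
    and "chromatic_number G \<ge> 4"
    and "\<not> (\<exists>H. subgraph H G \<and> isomorphic H (complete_graph 4))"
  shows "\<exists>C. cycle G C \<and> card (chords G C) \<ge> 4"
proof -
  define adj where "adj u v \<longleftrightarrow> {u, v} \<in> edges G" for u v
  have fin: "finite (verts G)" and edge: "\<And>e. e \<in> edges G \<Longrightarrow> e \<subseteq> verts G \<and> card e = 2"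
    using assms(1) by (auto simp: finite_simple_graph_def)
  \<comment> \<open>Vertex sets whose induced subgraph is not 3-colourable; an inclusion-minimal one
    will be the critical graph.\<close>
  let ?bad = "{A \<in> Pow (verts G). \<forall>c. \<not> three_colouring adj A c}"
  have "\<not> three_colouring adj (verts G) c" for c
  proof
    assume "three_colouring adj (verts G) c"
    then have "proper_colouring G 3 c"
      by (simp add: three_colouring_def proper_colouring_def adj_def)
    then have "chromatic_number G \<le> 3"
      unfolding chromatic_number_def by (intro Least_le) blast
    with assms(2) show False by simp
  qed
  then have "?bad \<noteq> {}" by blast
  moreover have "finite ?bad" using fin by simp
  ultimately have "\<exists>W\<in>?bad. \<forall>A\<in>?bad. A \<subseteq> W \<longrightarrow> W = A"
    using finite_has_minimal[of ?bad] by simp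
  then obtain W where W: "W \<in> ?bad" "\<And>A. A \<in> ?bad \<Longrightarrow> A \<subseteq> W \<Longrightarrow> W = A"
    by (elim bexE) blast
  interpret critical_graph adj W
  proof
    show "finite W" using W fin finite_subset by auto
    show "\<not> adj v v" for v using edge[of "{v, v}"] by (auto simp: adj_def)
    show "adj u v \<Longrightarrow> adj v u" for u v by (simp add: adj_def insert_commute)
    show "\<not> three_colouring adj W c" for c using W by blast
    show "\<exists>c. three_colouring adj A c" if "A \<subset> W" for A
      using W that by blast
  qed
  have "W \<subseteq> verts G" using W by blast
  have K4_free: False if "{a, b, c, d} \<subseteq> W" "distinct [a, b, c, d]"
    "adj a b" "adj a c" "adj a d" "adj b c" "adj b d" "adj c d" for a b c d
  proof -
    let ?S = "{a, b, c, d}"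
    let ?H = "(?S, {{x, y} | x y. x \<in> ?S \<and> y \<in> ?S \<and> x \<noteq> y})"
    have "{x, y} \<in> edges G" if "x \<in> ?S" "y \<in> ?S" "x \<noteq> y" for x y
      using that \<open>adj a b\<close> \<open>adj a c\<close> \<open>adj a d\<close> \<open>adj b c\<close> \<open>adj b d\<close> \<open>adj c d\<close>
      unfolding adj_def by (auto simp: insert_commute)
    then have "subgraph ?H G"
      using that(1) \<open>W \<subseteq> verts G\<close> unfolding subgraph_def finite_simple_graph_def by auto
    moreover have "isomorphic ?H (complete_graph 4)"
      using that(2) by (intro isomorphic_complete_graphI) auto
    ultimately show False using assms(3) by blast
  qed
  obtain C q where C: "length C = Suc (Suc q)" "2 \<le> q" "distinct C" "set C \<subseteq> W"
    "\<And>i. i \<le> q \<Longrightarrow> adj (C ! i) (C ! Suc i)" "adj (C ! 0) (C ! Suc q)"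
    and four: "4 \<le> card {(i, j). Suc (Suc i) \<le> j \<and> j \<le> Suc q \<and> (i, j) \<noteq> (0, Suc q) \<and> adj (C ! i) (C ! j)}"
      (is "4 \<le> card ?P")
    by (rule many_chords; (rule K4_free | rule that); assumption)
  have cyc: "cycle G C"
    unfolding cycle_def
  proof (intro conjI allI impI)
    show "{C ! i, C ! (Suc i mod length C)} \<in> edges G" if "i < length C" for i
    proof (cases "i = Suc q")
      case True
      with C(1,6) show ?thesis by (simp add: adj_def insert_commute)
    next
      case False
      with C(1) C(5)[of i] that show ?thesis by (simp add: adj_def)
    qed
  qed (use C \<open>W \<subseteq> verts G\<close> in auto)
  have chord: "{C ! i, C ! j} \<in> chords G C"
    if "Suc (Suc i) \<le> j" "j \<le> Suc q" "0 < i \<or> j \<noteq> Suc q" "adj (C ! i) (C ! j)" for i j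
    using that C(1,3) not_consecutive[of C i j] unfolding chords_def adj_def by force
  \<comment> \<open>Index pairs have the smaller index first and \<open>C\<close> is distinct, so
    different pairs give different chords as two-element sets.\<close>
  have le: "card ?P \<le> card (chords G C)"
  proof (rule card_inj_on_le)
    show "inj_on (\<lambda>(i, j). {C ! i, C ! j}) ?P"
      using C(1,3) by (auto simp: inj_on_def doubleton_eq_iff nth_eq_iff_index_eq)
    show "(\<lambda>(i, j). {C ! i, C ! j}) ` ?P \<subseteq> chords G C"
      using chord by (intro image_subsetI) (clarsimp simp del: insert_iff)
    show "finite (chords G C)"
      by (rule finite_subset[of _ "Pow (set C)"]) (auto simp: chords_def)
  qed
  show ?thesis using cyc order_trans[OF four le] by blast
qed

end
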